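(* Let $\langle F,E\rangle$ be a weak-* sequentially complete anti-dual pair and let $A,B\in\mathscr L(E;F)$ be positive operators. The following statements are equivalent: (i) the Lebesgue decomposition of $B$ into $A$-absolutely continuous and $A$-singular parts is unique; (ii) $\operatorname{dom}\widehat B^*\subseteq\mathcal H_B$ is closed; (iii) $\widehat B_{\mathrm{reg}}$ is norm continuous between $\mathcal H_A$ and $\mathcal H_B$; (iv) $B_a\le\alpha A$ for some $\alpha\ge0$; (v) $J_B(\mathcal M^\perp)\subseteq\operatorname{ran}J_A$, where $J_B(\mathcal M^\perp)$ is the image of $\mathcal M^\perp$ under $J_B$.
   Context: An anti-dual pair $\langle F,E\rangle$ consists of complex vector spaces $E,F$ and a map $\langle\cdot,\cdot\rangle:F\times E\to\mathbb C$, linear in the first and conjugate linear in the second variable, that separates the points of $E$ and of $F$. $\sigma(F,E)$ is the weak topology on $F$ induced by the functionals $\langle\cdot,x\rangle$ ($x\in E$), and $\sigma(E,F)$ is the weak topology on $E$ induced by the functionals $\langle f,\cdot\rangle$ ($f\in F$). The pair is weak-* sequentially complete if every Cauchy sequence of $(F,\sigma(F,E))$ converges. $\mathscr L(E;F)$ is the set of $\sigma(E,F)$-$\sigma(F,E)$ continuous linear operators $E\to F$. A linear operator $A:E\to F$ is positive if $\langle Ax,x\rangle\ge0$ for all $x\in E$ (such operators belong to $\mathscr L(E;F)$ automatically); $A\le B$ means that $B-A$ is positive. Absolute continuity: $B\ll A$ ($B$ is $A$-absolutely continuous) if for every sequence $(x_n)$ in $E$, $\langle Ax_n,x_n\rangle\to0$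 and $\langle B(x_n-x_m),x_n-x_m\rangle\to0$ ($n,m\to\infty$) imply $\langle Bx_n,x_n\rangle\to0$. Singularity: $A\perp B$ ($B$ is $A$-singular) if $C\le A$ and $C\le B$ imply $C=0$ for every positive $C\in\mathscr L(E;F)$. A Lebesgue decomposition of $B$ with respect to $A$ is a decomposition $B=B_1+B_2$ with positive operators $B_1\ll A$ and $B_2\perp A$; it is unique if there is only one such pair $(B_1,B_2)$. Auxiliary Hilbert spaces: for a positive $A$, $\mathcal H_A$ is the Hilbert completion of $\operatorname{ran}A$ under the (well-defined) inner product $(Ax\,|\,Ay)_A:=\langle Ax,y\rangle$. $J_A:\mathcal H_A\to F$ is the unique weakly continuous (weak topology of $\mathcal H_A$ to $\sigma(F,E)$) linear extension of the inclusion $\operatorname{ran}A\hookrightarrow F$; its adjoint $J_A^*:E\to\mathcal H_A$, determined by $\langle J_Ah,x\rangle=(h\,|\,J_A^*x)_A$, satisfies $J_A^*x=Ax$, and $A=J_AJ_A^*$. $\mathcal H_B$, $J_B$ are defined likewise. $\widehat B:=\overline{\{(Ax,Bx):x\in E\}}\subseteq\mathcal H_A\times\mathcal H_B$ is a closed linear relation. Its adjoint $\widehat B^*\subseteq\mathcal H_B\times\mathcal H_A$ consists of the pairs $(g,f)$ with $(k\,|\,g)_B=(h\,|\,f)_A$ for all $(h,k)\in\widehat B$ (it is a single-valued operator), and $\operatorname{dom}\widehat B^*$ is the set of its first components. $\mathcal M:=\{\xi\in\mathcal H_B:(0,\xi)\in\widehat B\}$, $P$ is the orthogonal projection of $\mathcal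 H_B$ onto $\mathcal M$, and $\widehat B_{\mathrm{reg}}:=\{(\zeta,(I-P)\xi):(\zeta,\xi)\in\widehat B\}$, which is (the graph of) a densely defined closed linear operator from $\mathcal H_A$ to $\mathcal H_B$. $B_a:=J_B(I-P)J_B^*$. *)

theory Defs
  imports "HOL-Analysis.Analysis"
begin

text \<open>Complex vector spaces and complex Hilbert spaces. The underlying real structure (scalar
  multiplication, inner product, hence also norm and topology) is required to be the one induced
  by the complex structure, so that the real library theory applies.\<close>

class complex_vector = real_vector +
  fixes scaleC :: "complex \<Rightarrow> 'a \<Rightarrow> 'a" (infixr "*\<^sub>C" 75)
  assumes scaleC_add_right: "a *\<^sub>C (x + y) = a *\<^sub>C x + a *\<^sub>C y"
    and scaleC_add_left: "(a + b) *\<^sub>C x = a *\<^sub>C x + b *\<^sub>C x"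
    and scaleC_scaleC: "a *\<^sub>C b *\<^sub>C x = (a * b) *\<^sub>C x"
    and scaleC_one: "1 *\<^sub>C x = x"
    and scaleR_scaleC: "r *\<^sub>R x = complex_of_real r *\<^sub>C x"

lemma vector_space_scaleC: "vector_space (scaleC :: complex \<Rightarrow> 'a::complex_vector \<Rightarrow> 'a)"
  by unfold_locales (simp_all add: scaleC_add_right scaleC_add_left scaleC_scaleC scaleC_one)

abbreviation clinear :: "('a::complex_vector \<Rightarrow> 'b::complex_vector) \<Rightarrow> bool" where
  "clinear \<equiv> Vector_Spaces.linear scaleC scaleC"

text \<open>Linear in the first argument; positive definiteness of \<open>cinner\<close> follows from
  \<open>cinner_commute\<close>, \<open>inner_eq_Re_cinner\<close> and positive definiteness of the real inner product.\<close>

class complex_inner = complex_vector + real_inner +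
  fixes cinner :: "'a \<Rightarrow> 'a \<Rightarrow> complex"
  assumes cinner_commute: "cinner x y = cnj (cinner y x)"
    and cinner_add_left: "cinner (x + y) z = cinner x z + cinner y z"
    and cinner_scaleC_left: "cinner (c *\<^sub>C x) y = c * cinner x y"
    and inner_eq_Re_cinner: "inner x y = Re (cinner x y)"

class chilbert_space = complex_inner + complete_space

instantiation complex :: chilbert_space
begin

definition scaleC_complex :: "complex \<Rightarrow> complex \<Rightarrow> complex" where
  "scaleC_complex a z = a * z"

definition cinner_complex :: "complex \<Rightarrow> complex \<Rightarrow> complex" where
  "cinner_complex z w = z * cnj w"

instance
  by standard
    (simp_all add: scaleC_complex_def cinner_complex_def algebra_simps inner_complex_def
      scaleR_conv_of_real)

end

text \<open>The weak (initial) topology induced by a family of functionals.\<close>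

definition weak_topology :: "('a \<Rightarrow> complex) set \<Rightarrow> 'a topology" where
  "weak_topology \<Phi> = topology_generated_by {\<phi> -` U | \<phi> U. \<phi> \<in> \<Phi> \<and> open U}"

definition weak_hilbert :: "'h::complex_inner topology" where
  "weak_hilbert = weak_topology (range (\<lambda>k h. cinner h k))"


text \<open>In what follows \<open>p f x\<close> stands for the value \<open>\<langle>f, x\<rangle>\<close> of the pairing of \<open>F\<close> and \<open>E\<close>.\<close>

definition anti_dual_pair :: "('f::complex_vector \<Rightarrow> 'e::complex_vector \<Rightarrow> complex) \<Rightarrow> bool" where
  "anti_dual_pair p \<longleftrightarrow>
     (\<forall>x. clinear (\<lambda>f. p f x)) \<and>
     (\<forall>f x y. p f (x + y) = p f x + p f y) \<and>
     (\<forall>f c x. p f (c *\<^sub>C x) = cnj c * p f x) \<and>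
     (\<forall>f. (\<forall>x. p f x = 0) \<longrightarrow> f = 0) \<and>
     (\<forall>x. (\<forall>f. p f x = 0) \<longrightarrow> x = 0)"

definition sigma_F :: "('f::complex_vector \<Rightarrow> 'e::complex_vector \<Rightarrow> complex) \<Rightarrow> 'f topology" where
  "sigma_F p = weak_topology (range (\<lambda>x f. p f x))"

definition sigma_E :: "('f::complex_vector \<Rightarrow> 'e::complex_vector \<Rightarrow> complex) \<Rightarrow> 'e topology" where
  "sigma_E p = weak_topology (range (\<lambda>f x. p f x))"

definition weak_star_Cauchy ::
  "('f::complex_vector \<Rightarrow> 'e::complex_vector \<Rightarrow> complex) \<Rightarrow> (nat \<Rightarrow> 'f) \<Rightarrow> bool" where
  "weak_star_Cauchy p f \<longleftrightarrow>
     (\<forall>U. openin (sigma_F p) U \<and> 0 \<in> U \<longrightarrow> (\<exists>N. \<forall>m\<ge>N. \<forall>n\<ge>N. f m - f n \<in> U))"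

definition weak_star_seq_complete ::
  "('f::complex_vector \<Rightarrow> 'e::complex_vector \<Rightarrow> complex) \<Rightarrow> bool" where
  "weak_star_seq_complete p \<longleftrightarrow>
     (\<forall>f. weak_star_Cauchy p f \<longrightarrow> (\<exists>l. limitin (sigma_F p) f l sequentially))"

definition weak_ops ::
  "('f::complex_vector \<Rightarrow> 'e::complex_vector \<Rightarrow> complex) \<Rightarrow> ('e \<Rightarrow> 'f) set" where
  "weak_ops p = {T. clinear T \<and> continuous_map (sigma_E p) (sigma_F p) T}"

definition positive_op ::
  "('f::complex_vector \<Rightarrow> 'e::complex_vector \<Rightarrow> complex) \<Rightarrow> ('e \<Rightarrow> 'f) \<Rightarrow> bool" where
  "positive_op p A \<longleftrightarrow> clinear A \<and> (\<forall>x. p (A x) x \<in> \<real>\<^sub>\<ge>\<^sub>0)"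

definition le_op ::
  "('f::complex_vector \<Rightarrow> 'e::complex_vector \<Rightarrow> complex) \<Rightarrow> ('e \<Rightarrow> 'f) \<Rightarrow> ('e \<Rightarrow> 'f) \<Rightarrow> bool" where
  "le_op p A B \<longleftrightarrow> positive_op p (\<lambda>x. B x - A x)"

text \<open>\<open>abs_cont p A B\<close> is \<open>B \<lless> A\<close>.\<close>

definition abs_cont ::
  "('f::complex_vector \<Rightarrow> 'e::complex_vector \<Rightarrow> complex) \<Rightarrow> ('e \<Rightarrow> 'f) \<Rightarrow> ('e \<Rightarrow> 'f) \<Rightarrow> bool" where
  "abs_cont p A B \<longleftrightarrow>
     (\<forall>x :: nat \<Rightarrow> 'e.
        (\<lambda>n. p (A (x n)) (x n)) \<longlonglongrightarrow> 0 \<and>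
        ((\<lambda>(n, m). p (B (x n - x m)) (x n - x m)) \<longlongrightarrow> 0) (sequentially \<times>\<^sub>F sequentially) \<longrightarrow>
        (\<lambda>n. p (B (x n)) (x n)) \<longlonglongrightarrow> 0)"

definition singular_op ::
  "('f::complex_vector \<Rightarrow> 'e::complex_vector \<Rightarrow> complex) \<Rightarrow> ('e \<Rightarrow> 'f) \<Rightarrow> ('e \<Rightarrow> 'f) \<Rightarrow> bool" where
  "singular_op p A B \<longleftrightarrow>
     (\<forall>C \<in> weak_ops p. positive_op p C \<and> le_op p C A \<and> le_op p C B \<longrightarrow> C = (\<lambda>x. 0))"

definition lebesgue_decompositions ::
  "('f::complex_vector \<Rightarrow> 'e::complex_vector \<Rightarrow> complex) \<Rightarrow> ('e \<Rightarrow> 'f) \<Rightarrow> ('e \<Rightarrow> 'f) \<Rightarrow>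
   (('e \<Rightarrow> 'f) \<times> ('e \<Rightarrow> 'f)) set" where
  "lebesgue_decompositions p A B =
     {(B1, B2). positive_op p B1 \<and> positive_op p B2 \<and> B = (\<lambda>x. B1 x + B2 x) \<and>
        abs_cont p A B1 \<and> singular_op p A B2}"


text \<open>\<open>hilbert_completion p A \<iota>\<close>: the Hilbert space \<open>'h\<close>, together with the canonical embedding
  \<open>\<iota>\<close> of \<open>ran A\<close>, is a Hilbert completion of \<open>ran A\<close> with respect to \<open>(A x | A y) = \<langle>A x, y\<rangle>\<close>.
  The values of \<open>\<iota>\<close> outside \<open>ran A\<close> are irrelevant.\<close>

definition hilbert_completion ::
  "('f::complex_vector \<Rightarrow> 'e::complex_vector \<Rightarrow> complex) \<Rightarrow> ('e \<Rightarrow> 'f) \<Rightarrow>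
   ('f \<Rightarrow> 'h::chilbert_space) \<Rightarrow> bool" where
  "hilbert_completion p A \<iota> \<longleftrightarrow>
     (\<forall>f\<in>range A. \<forall>g\<in>range A. \<iota> (f + g) = \<iota> f + \<iota> g) \<and>
     (\<forall>c. \<forall>f\<in>range A. \<iota> (c *\<^sub>C f) = c *\<^sub>C \<iota> f) \<and>
     (\<forall>x y. cinner (\<iota> (A x)) (\<iota> (A y)) = p (A x) y) \<and>
     closure (\<iota> ` range A) = UNIV"

definition J_op ::
  "('f::complex_vector \<Rightarrow> 'e::complex_vector \<Rightarrow> complex) \<Rightarrow> ('e \<Rightarrow> 'f) \<Rightarrow>
   ('f \<Rightarrow> 'h::chilbert_space) \<Rightarrow> 'h \<Rightarrow> 'f" where
  "J_op p A \<iota> = (THE J. clinear J \<and> continuous_map weak_hilbert (sigma_F p) J \<and>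
     (\<forall>f\<in>range A. J (\<iota> f) = f))"

definition J_adj ::
  "('f::complex_vector \<Rightarrow> 'e::complex_vector \<Rightarrow> complex) \<Rightarrow> ('e \<Rightarrow> 'f) \<Rightarrow>
   ('f \<Rightarrow> 'h::chilbert_space) \<Rightarrow> 'e \<Rightarrow> 'h" where
  "J_adj p A \<iota> x = (THE k. \<forall>h. p (J_op p A \<iota> h) x = cinner h k)"


definition orth_compl :: "'h::complex_inner set \<Rightarrow> 'h set" where
  "orth_compl M = {x. \<forall>m\<in>M. cinner x m = 0}"

definition orth_proj :: "'h::complex_inner set \<Rightarrow> 'h \<Rightarrow> 'h" where
  "orth_proj M x = (THE m. m \<in> M \<and> x - m \<in> orth_compl M)"

definition rel_adjoint :: "('h::complex_inner \<times> 'k::complex_inner) set \<Rightarrow> ('k \<times> 'h) set" where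
  "rel_adjoint R = {(g, f). \<forall>(h, k)\<in>R. cinner k g = cinner h f}"

definition mul_part :: "('h::complex_inner \<times> 'k::complex_inner) set \<Rightarrow> 'k set" where
  "mul_part R = {\<xi>. (0, \<xi>) \<in> R}"

definition reg_part :: "('h::complex_inner \<times> 'k::complex_inner) set \<Rightarrow> ('h \<times> 'k) set" where
  "reg_part R = {(\<zeta>, \<xi> - orth_proj (mul_part R) \<xi>) | \<zeta> \<xi>. (\<zeta>, \<xi>) \<in> R}"

text \<open>The operator on \<open>Domain G\<close> whose graph is the single-valued relation \<open>G\<close>.\<close>

definition graph_op :: "('h \<times> 'k) set \<Rightarrow> 'h \<Rightarrow> 'k" where
  "graph_op G \<zeta> = (THE \<xi>. (\<zeta>, \<xi>) \<in> G)"

definition B_hat ::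
  "('e \<Rightarrow> 'f) \<Rightarrow> ('f \<Rightarrow> 'h::chilbert_space) \<Rightarrow> ('e \<Rightarrow> 'f) \<Rightarrow> ('f \<Rightarrow> 'k::chilbert_space) \<Rightarrow>
   ('h \<times> 'k) set" where
  "B_hat A \<iota>A B \<iota>B = closure (range (\<lambda>x. (\<iota>A (A x), \<iota>B (B x))))"

text \<open>\<open>J\<^sub>B (I - P) J\<^sub>B\<^sup>*\<close>, where \<open>P\<close> is the orthogonal projection onto \<open>M\<close>.\<close>

definition compress_op ::
  "('f::complex_vector \<Rightarrow> 'e::complex_vector \<Rightarrow> complex) \<Rightarrow> ('e \<Rightarrow> 'f) \<Rightarrow>
   ('f \<Rightarrow> 'k::chilbert_space) \<Rightarrow> 'k set \<Rightarrow> 'e \<Rightarrow> 'f" where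
  "compress_op p B \<iota>B M x =
     J_op p B \<iota>B (J_adj p B \<iota>B x - orth_proj M (J_adj p B \<iota>B x))"

definition B_a ::
  "('f::complex_vector \<Rightarrow> 'e::complex_vector \<Rightarrow> complex) \<Rightarrow>
   ('e \<Rightarrow> 'f) \<Rightarrow> ('f \<Rightarrow> 'h::chilbert_space) \<Rightarrow> ('e \<Rightarrow> 'f) \<Rightarrow> ('f \<Rightarrow> 'k::chilbert_space) \<Rightarrow>
   'e \<Rightarrow> 'f" where
  "B_a p A \<iota>A B \<iota>B = compress_op p B \<iota>B (mul_part (B_hat A \<iota>A B \<iota>B))"

end

theory Submission
  imports Defs
begin

text \<open>
  Write \<open>a x = A x \<in> \<H>\<^sub>A\<close> and \<open>b x = B x \<in> \<H>\<^sub>B\<close>. A vector \<open>g\<close> lies in \<open>dom Bhat\<^sup>*\<close> iff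
  \<open>(b x | g) = (a x | f)\<close> for some \<open>f\<close> and all \<open>x\<close>, that is, iff \<open>J\<^sub>B g \<in> ran J\<^sub>A\<close>, and \<open>dom Bhat\<^sup>*\<close>
  is dense in \<open>\<M>\<^sup>\<bottom>\<close>. Hence (ii) and (v) both say \<open>\<M>\<^sup>\<bottom> = dom Bhat\<^sup>*\<close>, while (iii) and (iv) both say
  that \<open>\<parallel>(I - P) b x\<parallel> \<le> c \<parallel>a x\<parallel>\<close>; these two conditions are equivalent by Riesz representation and
  the uniform boundedness principle.

  If \<open>B\<^sub>a \<le> \<alpha> A\<close>, then the absolutely continuous part \<open>B\<^sub>1\<close> of any decomposition satisfies \<open>B\<^sub>1 \<le> B\<^sub>a\<close>,
  and a multiple of \<open>B\<^sub>a - B\<^sub>1\<close> lies below both \<open>A\<close> and the singular part, so that \<open>B\<^sub>1 = B\<^sub>a\<close>.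
  Conversely, for a unit vector \<open>g \<in> \<M>\<^sup>\<bottom> - dom Bhat\<^sup>*\<close> the compressions of \<open>B\<close> to
  \<open>\<M>\<^sup>\<bottom> \<inter> {g}\<^sup>\<bottom>\<close> and to its orthogonal complement form a second Lebesgue decomposition.
\<close>

section \<open>Complex Hilbert spaces\<close>

interpretation complex_vector: vector_space "scaleC :: complex \<Rightarrow> 'a::complex_vector \<Rightarrow> 'a"
  by (rule vector_space_scaleC)

lemma clinear_iff:
  "clinear f \<longleftrightarrow> (\<forall>x y. f (x + y) = f x + f y) \<and> (\<forall>c x. f (c *\<^sub>C x) = c *\<^sub>C f x)"
  by (simp add: Vector_Spaces.linear_iff vector_space_scaleC)

lemma clinear_add: "clinear f \<Longrightarrow> f (x + y) = f x + f y"
  and clinear_scaleC: "clinear f \<Longrightarrow> f (c *\<^sub>C x) = c *\<^sub>C f x"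
  by (simp_all add: clinear_iff)

lemma clinear_0: "clinear f \<Longrightarrow> f 0 = 0"
  and clinear_diff: "clinear f \<Longrightarrow> f (x - y) = f x - f y"
  unfolding Vector_Spaces.linear_def by (blast intro: module_hom.zero module_hom.diff)+

lemma clinear_scaleR: "clinear f \<Longrightarrow> f (r *\<^sub>R x) = r *\<^sub>R f x"
  by (simp add: clinear_scaleC scaleR_scaleC)

lemma clinear_comp: "clinear f \<Longrightarrow> clinear g \<Longrightarrow> clinear (\<lambda>x. g (f x))"
  by (simp add: clinear_iff)

lemma clinear_complex_iff:
  fixes f :: "'a::complex_vector \<Rightarrow> complex"
  shows "clinear f \<longleftrightarrow> (\<forall>x y. f (x + y) = f x + f y) \<and> (\<forall>c x. f (c *\<^sub>C x) = c * f x)"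
  by (simp add: clinear_iff scaleC_complex_def)

lemma subspace_if_csubspace: "complex_vector.subspace S \<Longrightarrow> subspace S"
  by (simp add: complex_vector.subspace_def subspace_def scaleR_scaleC)

section \<open>Elementary rules for the complex inner product\<close>

lemma cinner_add_right: "cinner x (y + z) = cinner x y + cinner x z"
  by (metis cinner_add_left cinner_commute complex_cnj_add)

lemma cinner_scaleC_right: "cinner x (c *\<^sub>C y) = cnj c * cinner x y"
  by (metis cinner_commute cinner_scaleC_left complex_cnj_mult)

lemma cinner_zero_left [simp]: "cinner 0 x = 0"
  using cinner_scaleC_left[of 0 0 x] by simp

lemma cinner_zero_right [simp]: "cinner x 0 = 0"
  using cinner_scaleC_right[of x 0 0] by simp

lemma cinner_diff_left: "cinner (x - y) z = cinner x z - cinner y z"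
  by (metis add_diff_cancel cinner_add_left diff_add_cancel)

lemma cinner_diff_right: "cinner x (y - z) = cinner x y - cinner x z"
  by (metis add_diff_cancel cinner_add_right diff_add_cancel)

lemma cinner_self: "cinner x x = complex_of_real ((norm x)\<^sup>2)"
proof -
  have "Im (cinner x x) = 0"
    using cinner_commute[of x x] by (simp add: complex_eq_iff)
  moreover have "Re (cinner x x) = (norm x)\<^sup>2"
    by (simp add: power2_norm_eq_inner inner_eq_Re_cinner)
  ultimately show ?thesis
    by (simp add: complex_eq_iff)
qed

lemma cinner_self_eq_0 [simp]: "cinner x x = 0 \<longleftrightarrow> x = 0"
  by (simp add: cinner_self)

lemma cinner_eq_0_commute: "cinner x y = 0 \<longleftrightarrow> cinner y x = 0"
  by (metis cinner_commute complex_cnj_zero)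

lemma cinner_ext: "(\<And>h. cinner h x = cinner h y) \<Longrightarrow> x = y"
  by (metis cinner_diff_right cinner_self_eq_0 eq_iff_diff_eq_0)

lemma norm_scaleC: "norm (c *\<^sub>C x) = norm c * norm (x :: 'a::complex_inner)"
proof -
  have "complex_of_real ((norm (c *\<^sub>C x))\<^sup>2) = complex_of_real ((norm c * norm x)\<^sup>2)"
    unfolding power_mult_distrib of_real_mult complex_norm_square
      cinner_self[of x, symmetric] cinner_self[of "c *\<^sub>C x", symmetric]
    by (simp add: cinner_scaleC_left cinner_scaleC_right mult.assoc)
  then show ?thesis
    by (simp del: of_real_power of_real_mult)
qed

lemma bounded_linear_scaleC: "bounded_linear (\<lambda>x :: 'a::complex_inner. c *\<^sub>C x)"
  by (rule bounded_linear_intro[where K = "norm c"])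
    (simp_all add: scaleC_add_right scaleR_scaleC scaleC_scaleC norm_scaleC mult.commute)

text \<open>Multiplying \<open>x\<close> by a unimodular scalar turns the complex inner product into
  its modulus, so the real Cauchy-Schwarz inequality applies.\<close>

lemma norm_cinner_le: "norm (cinner x y) \<le> norm x * norm y"
proof (cases "cinner x y = 0")
  case False
  define u where "u = cnj (sgn (cinner x y))"
  have "u * cinner x y = complex_of_real (norm (cinner x y))"
    using False complex_norm_square[of "cinner x y"] unfolding u_def
    by (simp add: sgn_eq power2_eq_square field_simps)
  then have "norm (cinner x y) = inner (u *\<^sub>C x) y"
    by (simp add: inner_eq_Re_cinner cinner_scaleC_left)
  also have "\<dots> \<le> norm (u *\<^sub>C x) * norm y"
    by (rule norm_cauchy_schwarz)
  also have "norm u = 1"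
    using False by (simp add: u_def norm_sgn)
  then have "norm (u *\<^sub>C x) = norm x"
    by (simp add: norm_scaleC)
  finally show ?thesis .
qed simp

lemma bounded_linear_cinner_left: "bounded_linear (\<lambda>x. cinner x y)"
  by (rule bounded_linear_intro[where K = "norm y"])
    (simp_all add: cinner_add_left scaleR_scaleC cinner_scaleC_left norm_cinner_le
      scaleR_conv_of_real scaleC_complex_def)

lemma bounded_linear_cinner_right: "bounded_linear (\<lambda>y. cinner x y)"
  by (rule bounded_linear_intro[where K = "norm x"])
    (use norm_cinner_le[of x] in \<open>simp_all add: cinner_add_right scaleR_scaleC cinner_scaleC_right
      scaleR_conv_of_real scaleC_complex_def mult.commute\<close>)

lemmas tendsto_cinner_left = bounded_linear.tendsto[OF bounded_linear_cinner_left]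

lemma clinear_cinner_left: "clinear (\<lambda>x. cinner x y)"
  by (simp add: clinear_complex_iff cinner_add_left cinner_scaleC_left)

section \<open>Closed subspaces, orthogonal complements and projections\<close>

lemma csubspace_closure:
  fixes S :: "'a::complex_inner set"
  assumes S: "complex_vector.subspace S"
  shows "complex_vector.subspace (closure S)"
proof -
  have "x + y \<in> closure S" if "x \<in> closure S" "y \<in> closure S" for x y
  proof -
    obtain f g where "\<And>n. f n \<in> S" "f \<longlonglongrightarrow> x" "\<And>n. g n \<in> S" "g \<longlonglongrightarrow> y"
      using \<open>x \<in> closure S\<close> \<open>y \<in> closure S\<close> by (auto simp: closure_sequential)
    then have "(\<lambda>n. f n + g n) \<longlonglongrightarrow> x + y" "\<And>n. f n + g n \<in> S"
      by (auto intro: tendsto_add complex_vector.subspace_add[OF S])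
    then show ?thesis
      unfolding closure_sequential by (intro exI conjI allI)
  qed
  moreover have "c *\<^sub>C x \<in> closure S" if "x \<in> closure S" for c x
  proof -
    obtain f where "\<And>n. f n \<in> S" "f \<longlonglongrightarrow> x"
      using \<open>x \<in> closure S\<close> by (auto simp: closure_sequential)
    then have "(\<lambda>n. c *\<^sub>C f n) \<longlonglongrightarrow> c *\<^sub>C x" "\<And>n. c *\<^sub>C f n \<in> S"
      by (auto intro: bounded_linear.tendsto[OF bounded_linear_scaleC] complex_vector.subspace_scale[OF S])
    then show ?thesis
      unfolding closure_sequential by (intro exI conjI allI)
  qed
  moreover have "0 \<in> closure S"
    using complex_vector.subspace_0[OF S] closure_subset by blast
  ultimately show ?thesis
    by (simp add: complex_vector.subspace_def)
qed

lemma csubspace_orth_compl: "complex_vector.subspace (orth_compl S)"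
  by (auto simp: complex_vector.subspace_def orth_compl_def cinner_add_left cinner_scaleC_left)

lemma closed_orth_compl: "closed (orth_compl S)"
proof -
  have "orth_compl S = (\<Inter>m\<in>S. {x. cinner x m = 0})"
    by (auto simp: orth_compl_def)
  moreover have "closed {x. cinner x m = 0}" for m :: 'a
    by (intro closed_Collect_eq bounded_linear.continuous_on[OF bounded_linear_cinner_left]
        continuous_intros)
  ultimately show ?thesis
    by (metis closed_INT)
qed

text \<open>Nearest point argument: a minimising sequence converges, and its limit is orthogonal up
  to \<open>S\<close>. The real form serves both complex subspaces and the closed relation in the
  product \<open>'h \<times> 'k\<close>, which is treated as a real space.\<close>

lemma closed_subspace_projection:
  fixes S :: "'a::{real_inner, complete_space} set"
  assumes "subspace S" "closed S"
  obtains m where "m \<in> S" "\<And>s. s \<in> S \<Longrightarrow> inner (x - m) s = 0"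
proof -
  define D where "D = (INF s\<in>S. (norm (x - s))\<^sup>2)"
  have bdd: "bdd_below ((\<lambda>s. (norm (x - s))\<^sup>2) ` S)"
    by (rule bdd_belowI2[where m = 0]) simp
  have D: "D \<le> (norm (x - s))\<^sup>2" if "s \<in> S" for s
    unfolding D_def using bdd that by (rule cINF_lower)
  have "\<exists>s\<in>S. (norm (x - s))\<^sup>2 < D + inverse (Suc n)" for n
  proof -
    have "S \<noteq> {}"
      using assms(1) subspace_0 by auto
    then show ?thesis
      using cINF_less_iff[OF _ bdd, of "D + inverse (Suc n)"] by (simp add: D_def)
  qed
  then obtain f where f: "\<And>n. f n \<in> S" "\<And>n. (norm (x - f n))\<^sup>2 < D + inverse (Suc n)"
    by metis
  \<comment> \<open>Parallelogram law; the midpoint of \<open>f i\<close> and \<open>f j\<close>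
    lies in \<open>S\<close>, so its squared distance from \<open>x\<close> is at least
    \<open>D\<close>.\<close>
  have par: "(norm (f i - f j))\<^sup>2 \<le> 2 * inverse (Suc i) + 2 * inverse (Suc j)" for i j
  proof -
    have "(norm (f i - f j))\<^sup>2 + 4 * (norm (x - (1/2) *\<^sub>R (f i + f j)))\<^sup>2
        = 2 * (norm (x - f i))\<^sup>2 + 2 * (norm (x - f j))\<^sup>2"
      unfolding power2_norm_eq_inner
      by (simp add: inner_diff_left inner_diff_right inner_add_left inner_add_right inner_commute
          algebra_simps)
    moreover have "D \<le> (norm (x - (1/2) *\<^sub>R (f i + f j)))\<^sup>2"
      by (intro D subspace_scale subspace_add assms f)
    ultimately show ?thesis
      using f(2)[of i] f(2)[of j] by linarith
  qed
  have "Cauchy f"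
  proof (rule metric_CauchyI)
    fix e :: real assume "e > 0"
    then obtain N where N: "inverse (Suc N) < e\<^sup>2 / 4"
      using reals_Archimedean[of "e\<^sup>2 / 4"] by auto
    have "dist (f i) (f j) < e" if "i \<ge> N" "j \<ge> N" for i j
    proof -
      have "inverse (Suc i) \<le> inverse (Suc N)" "inverse (Suc j) \<le> inverse (Suc N)"
        using that by (simp_all add: field_simps)
      then have "(norm (f i - f j))\<^sup>2 < e\<^sup>2"
        using par[of i j] N by linarith
      then show ?thesis
        using \<open>e > 0\<close> by (simp add: dist_norm power_less_imp_less_base)
    qed
    then show "\<exists>N. \<forall>m\<ge>N. \<forall>n\<ge>N. dist (f m) (f n) < e"
      by blast
  qed
  then obtain m where m: "f \<longlonglongrightarrow> m"
    using Cauchy_convergent convergent_def by blast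
  then have "m \<in> S"
    using assms(2) f(1) closed_sequentially by blast
  have "(\<lambda>n. (norm (x - f n))\<^sup>2) \<longlonglongrightarrow> (norm (x - m))\<^sup>2"
    by (intro tendsto_intros m)
  moreover have "(\<lambda>n. D + inverse (Suc n)) \<longlonglongrightarrow> D + 0"
    by (intro tendsto_intros LIMSEQ_inverse_real_of_nat)
  ultimately have mD: "(norm (x - m))\<^sup>2 \<le> D"
    using f(2) by (intro LIMSEQ_le[where Y = "\<lambda>n. D + inverse (Suc n)"]) (auto intro: less_imp_le)
  have "inner (x - m) s = 0" if "s \<in> S" for s
  proof (cases "s = 0")
    case False
    \<comment> \<open>The minimiser of the quadratic polynomial giving the squared norm of
      \<open>(x - m) - t *\<^sub>R s\<close>.\<close>
    define t where "t = inner (x - m) s / inner s s"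
    have "(norm (x - m))\<^sup>2 \<le> (norm (x - (m + t *\<^sub>R s)))\<^sup>2"
      using mD by (rule order_trans) (intro D subspace_add subspace_scale assms \<open>m \<in> S\<close> that)
    also have "x - (m + t *\<^sub>R s) = (x - m) - t *\<^sub>R s"
      by simp
    also have "(norm ((x - m) - t *\<^sub>R s))\<^sup>2
        = (norm (x - m))\<^sup>2 - 2 * t * inner (x - m) s + t\<^sup>2 * inner s s"
      unfolding power2_norm_eq_inner
      by (simp add: inner_diff_left inner_diff_right inner_commute power2_eq_square algebra_simps)
    also have "\<dots> = (norm (x - m))\<^sup>2 - (inner (x - m) s)\<^sup>2 / inner s s"
      using False by (simp add: t_def power2_eq_square field_simps)
    finally have "(inner (x - m) s)\<^sup>2 / inner s s \<le> 0"
      by simp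
    moreover have "inner s s > 0"
      using False by simp
    ultimately show ?thesis
      by (simp add: divide_le_0_iff)
  qed simp
  then show thesis
    using that \<open>m \<in> S\<close> by blast
qed

text \<open>Real orthogonality to \<open>\<i> *\<^sub>C s\<close> makes the imaginary part of the
  complex inner product vanish as well.\<close>

lemma csubspace_real_orthogonal:
  assumes "complex_vector.subspace S" "\<And>s. s \<in> S \<Longrightarrow> inner x s = 0" "s \<in> S"
  shows "cinner x s = 0"
proof -
  have "inner x (\<i> *\<^sub>C s) = 0"
    using assms complex_vector.subspace_scale by blast
  then show ?thesis
    using assms(2,3)
    by (simp add: inner_eq_Re_cinner cinner_scaleC_right complex_eq_iff)
qed

lemma orth_proj_eqI:
  assumes "complex_vector.subspace S" "m \<in> S" "x - m \<in> orth_compl S"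
  shows "orth_proj S x = m"
  unfolding orth_proj_def
proof (rule the_equality)
  fix n assume n: "n \<in> S \<and> x - n \<in> orth_compl S"
  have "(x - m) - (x - n) \<in> orth_compl S"
    using assms n csubspace_orth_compl complex_vector.subspace_diff by blast
  then have "n - m \<in> orth_compl S"
    by simp
  moreover have "n - m \<in> S"
    using assms n complex_vector.subspace_diff by blast
  ultimately have "cinner (n - m) (n - m) = 0"
    by (simp add: orth_compl_def)
  then show "n = m"
    by simp
qed (use assms in simp)

locale closed_csubspace =
  fixes S :: "'a::chilbert_space set"
  assumes csubspace: "complex_vector.subspace S" and closed: "closed S"
begin

lemma orth_proj: "orth_proj S x \<in> S" "x - orth_proj S x \<in> orth_compl S"
proof -
  obtain m where m: "m \<in> S" "\<And>s. s \<in> S \<Longrightarrow> inner (x - m) s = 0"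
    using closed_subspace_projection[OF subspace_if_csubspace[OF csubspace] closed] by blast
  then have "x - m \<in> orth_compl S"
    using csubspace_real_orthogonal[OF csubspace] by (auto simp: orth_compl_def)
  with m show "orth_proj S x \<in> S" "x - orth_proj S x \<in> orth_compl S"
    using orth_proj_eqI[OF csubspace] by metis+
qed

lemma orth_proj_id: "x \<in> S \<Longrightarrow> orth_proj S x = x"
  by (rule orth_proj_eqI[OF csubspace]) (simp_all add: orth_compl_def)

text \<open>A vector of the double complement has a residual \<open>x - orth_proj S x\<close> that
  is orthogonal both to \<open>x\<close> and to its projection, hence to itself.\<close>

lemma orth_compl_orth_compl: "orth_compl (orth_compl S) = S"
proof
  show "orth_compl (orth_compl S) \<subseteq> S"
  proof
    fix x assume "x \<in> orth_compl (orth_compl S)"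
    then have "cinner x (x - orth_proj S x) = 0"
      using orth_proj(2) by (simp add: orth_compl_def)
    moreover have "cinner (orth_proj S x) (x - orth_proj S x) = 0"
      using orth_proj[of x] cinner_eq_0_commute by (auto simp: orth_compl_def)
    ultimately have "cinner (x - orth_proj S x) (x - orth_proj S x) = 0"
      by (simp add: cinner_diff_left)
    then show "x \<in> S"
      using orth_proj(1)[of x] by simp
  qed
  show "S \<subseteq> orth_compl (orth_compl S)"
    using cinner_eq_0_commute by (auto simp: orth_compl_def)
qed

lemma orth_proj_orth_compl: "orth_proj (orth_compl S) x = x - orth_proj S x"
  by (rule orth_proj_eqI[OF csubspace_orth_compl]) (simp_all add: orth_proj orth_compl_orth_compl)

lemma clinear_orth_proj: "clinear (orth_proj S)"
proof -
  have "orth_proj S (x + y) = orth_proj S x + orth_proj S y" for x y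
  proof (rule orth_proj_eqI[OF csubspace])
    show "orth_proj S x + orth_proj S y \<in> S"
      by (intro complex_vector.subspace_add csubspace orth_proj)
    have "(x - orth_proj S x) + (y - orth_proj S y) \<in> orth_compl S"
      by (intro complex_vector.subspace_add csubspace_orth_compl orth_proj)
    then show "x + y - (orth_proj S x + orth_proj S y) \<in> orth_compl S"
      by (simp add: algebra_simps)
  qed
  moreover have "orth_proj S (c *\<^sub>C x) = c *\<^sub>C orth_proj S x" for c x
  proof (rule orth_proj_eqI[OF csubspace])
    show "c *\<^sub>C orth_proj S x \<in> S"
      by (intro complex_vector.subspace_scale csubspace orth_proj)
    have "c *\<^sub>C (x - orth_proj S x) \<in> orth_compl S"
      by (intro complex_vector.subspace_scale csubspace_orth_compl orth_proj)
    then show "c *\<^sub>C x - c *\<^sub>C orth_proj S x \<in> orth_compl S"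
      by (simp add: complex_vector.scale_right_diff_distrib)
  qed
  ultimately show ?thesis
    by (simp add: clinear_iff)
qed

lemma cinner_orth_proj_orth_proj: "cinner (orth_proj S x) (orth_proj S y) = cinner (orth_proj S x) y"
proof -
  have "cinner (orth_proj S x) (y - orth_proj S y) = 0"
    using orth_proj[of x] orth_proj[of y] cinner_eq_0_commute by (auto simp: orth_compl_def)
  then show ?thesis
    by (simp add: cinner_diff_right)
qed

lemma cinner_orth_proj: "cinner (orth_proj S x) y = cinner x (orth_proj S y)"
  by (metis cinner_commute cinner_orth_proj_orth_proj)

lemma norm_orth_proj_le: "norm (orth_proj S x) \<le> norm x"
proof -
  have "(norm (orth_proj S x))\<^sup>2 = norm (cinner (orth_proj S x) x)"
    using cinner_orth_proj_orth_proj[of x x] by (metis cinner_self norm_of_real abs_power2)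
  also have "\<dots> \<le> norm (orth_proj S x) * norm x"
    by (rule norm_cinner_le)
  finally show ?thesis
    by (cases "orth_proj S x = 0") (simp_all add: power2_eq_square)
qed

lemma bounded_linear_orth_proj: "bounded_linear (orth_proj S)"
  by (rule bounded_linear_intro[where K = 1])
    (simp_all add: clinear_add[OF clinear_orth_proj] clinear_scaleR[OF clinear_orth_proj]
      norm_orth_proj_le)

end

lemma closed_csubspace_orth_compl: "closed_csubspace (orth_compl S)"
  by unfold_locales (rule csubspace_orth_compl closed_orth_compl)+

section \<open>Riesz representation and uniform boundedness\<close>

lemma riesz_along_clinear:
  fixes a :: "'e::complex_vector \<Rightarrow> 'h::chilbert_space" and \<phi> :: "'e \<Rightarrow> complex"
  assumes a: "clinear a" and \<phi>: "clinear \<phi>" and bound: "\<And>x. norm (\<phi> x) \<le> c * norm (a x)"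
  obtains f where "\<And>x. \<phi> x = cinner (a x) f"
proof (cases "\<forall>x. \<phi> x = 0")
  case True
  then show thesis
    using that[of 0] by simp
next
  case False
  then obtain x1 where x1: "\<phi> x1 \<noteq> 0"
    by blast
  define x0 where "x0 = inverse (\<phi> x1) *\<^sub>C x1"
  have x0: "\<phi> x0 = 1"
    using x1 \<phi> by (simp add: x0_def clinear_complex_iff)
  \<comment> \<open>The image of the kernel of \<open>\<phi>\<close>. As in the classical Riesz
    proof, the representing vector is a multiple of a vector orthogonal to the closure of this
    image.\<close>
  define N where "N = a ` {x. \<phi> x = 0}"
  have "complex_vector.subspace {x. \<phi> x = 0}"
    using \<phi> by (simp add: complex_vector.subspace_def clinear_complex_iff clinear_0)
  then have "complex_vector.subspace N"
    using a unfolding N_def linear_iff_module_hom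
    by (simp add: module_hom.subspace_image)
  then interpret N: closed_csubspace "closure N"
    by unfold_locales (simp_all add: csubspace_closure)
  define u where "u = a x0 - orth_proj (closure N) (a x0)"
  have u_orth: "u \<in> orth_compl (closure N)"
    unfolding u_def by (rule N.orth_proj)
  have u_ker: "cinner (a x) u = 0" if "\<phi> x = 0" for x
  proof -
    have "a x \<in> closure N"
      using that by (intro subsetD[OF closure_subset]) (auto simp: N_def)
    then show ?thesis
      using u_orth cinner_eq_0_commute by (auto simp: orth_compl_def)
  qed
  \<comment> \<open>Otherwise \<open>a x0\<close> is a limit of vectors \<open>a (x n)\<close> with
    \<open>x n\<close> in the kernel, although \<open>\<phi> (x0 - x n) = 1\<close> is bounded by a
    multiple of the distance.\<close>
  have "u \<noteq> 0"
  proof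
    assume "u = 0"
    then have "a x0 \<in> closure N"
      using N.orth_proj(1)[of "a x0"] by (simp add: u_def)
    then obtain g where "\<And>n. g n \<in> N" "g \<longlonglongrightarrow> a x0"
      by (auto simp: closure_sequential)
    then have "\<forall>n. \<exists>x. \<phi> x = 0 \<and> g n = a x"
      by (auto simp: N_def)
    then obtain x where "\<And>n. \<phi> (x n) = 0" "g = (\<lambda>n. a (x n))"
      unfolding fun_eq_iff by metis
    with \<open>g \<longlonglongrightarrow> a x0\<close> have x: "\<And>n. \<phi> (x n) = 0" "(\<lambda>n. a (x n)) \<longlonglongrightarrow> a x0"
      by simp_all
    have "norm (\<phi> (x0 - x n)) = 1" for n
      using x0 x(1) by (simp add: clinear_diff[OF \<phi>])
    then have "1 \<le> c * norm (a x0 - a (x n))" for n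
      using bound[of "x0 - x n"] by (simp add: clinear_diff[OF a])
    moreover have "(\<lambda>n. c * norm (a x0 - a (x n))) \<longlonglongrightarrow> c * norm (a x0 - a x0)"
      by (intro tendsto_intros x)
    ultimately have "1 \<le> c * norm (a x0 - a x0)"
      by (intro LIMSEQ_le_const) auto
    then show False
      by simp
  qed
  \<comment> \<open>Since \<open>\<phi> x0 = 1\<close>, the vector
    \<open>x - \<phi> x *\<^sub>C x0\<close> lies in the kernel; dividing \<open>u\<close> by
    \<open>cinner u u\<close> then yields the representing vector.\<close>
  have eq: "cinner (a x) u = \<phi> x * cinner u u" for x
  proof -
    have "cinner (a (x - \<phi> x *\<^sub>C x0)) u = 0"
      using x0 \<phi> by (intro u_ker) (simp add: clinear_diff clinear_complex_iff)
    moreover have "cinner (orth_proj (closure N) (a x0)) u = 0"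
      using u_orth N.orth_proj(1) cinner_eq_0_commute unfolding orth_compl_def by blast
    then have "cinner (a x0) u = cinner u u"
      by (simp add: u_def cinner_diff_left)
    ultimately show ?thesis
      by (simp add: clinear_diff[OF a] clinear_scaleC[OF a] cinner_diff_left cinner_scaleC_left)
  qed
  show thesis
  proof (rule that)
    fix x
    have "cnj (cinner u u) = cinner u u"
      by (rule cinner_commute[symmetric])
    then show "\<phi> x = cinner (a x) (inverse (cinner u u) *\<^sub>C u)"
      using \<open>u \<noteq> 0\<close> by (simp add: cinner_scaleC_right eq)
  qed
qed

text \<open>Uniform boundedness principle, with \<open>s\<close> acting by
  \<open>g \<mapsto> cinner s g\<close>. The closed sets \<open>F n\<close> exhaust the Hilbert
  space, so by the Baire category theorem one of them contains a ball.\<close>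

lemma weakly_bounded_imp_norm_bounded:
  fixes S :: "'k::chilbert_space set"
  assumes bound: "\<And>g. \<exists>c. \<forall>s\<in>S. norm (cinner s g) \<le> c"
  obtains c where "\<And>s. s \<in> S \<Longrightarrow> norm s \<le> c"
proof -
  define F where "F n = {g. \<forall>s\<in>S. norm (cinner s g) \<le> real n}" for n
  have F_eq: "F n = (\<Inter>s\<in>S. {g. norm (cinner s g) \<le> real n})" for n
    by (auto simp: F_def)
  have "closed {g. norm (cinner s g) \<le> r}" for s :: 'k and r
    by (intro closed_Collect_le continuous_intros
        bounded_linear.continuous_on[OF bounded_linear_cinner_right])
  then have "closed (F n)" for n
    unfolding F_eq by (intro closed_INT ballI)
  have "g \<in> (\<Union>n. F n)" for g
  proof -
    obtain c where c: "\<forall>s\<in>S. norm (cinner s g) \<le> c"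
      using bound by blast
    obtain n where "c \<le> real n"
      using real_arch_simple by blast
    with c have "g \<in> F n"
      unfolding F_def using order_trans by blast
    then show ?thesis
      by blast
  qed
  then have "(\<Union>n. F n) = UNIV"
    by blast
  have "\<exists>n. interior (F n) \<noteq> {}"
  proof (rule ccontr)
    assume "\<nexists>n. interior (F n) \<noteq> {}"
    then have "euclidean interior_of \<Union>(range F) = {}"
      using \<open>\<And>n. closed (F n)\<close>
      by (intro Baire_category_alt) (auto simp: completely_metrizable_space_euclidean)
    then show False
      using \<open>(\<Union>n. F n) = UNIV\<close> by simp
  qed
  then obtain n g r where "0 < r" and ball: "ball g r \<subseteq> F n"
    using mem_interior by blast
  show thesis
  proof (rule that)
    fix s assume "s \<in> S"
    show "norm s \<le> 4 * real n / r"
    proof (cases "s = 0")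
      case False
      \<comment> \<open>A multiple of \<open>s\<close> of length \<open>r / 2\<close>, short enough
        for \<open>g + u\<close> to stay in the ball. The values at \<open>g\<close> and
        \<open>g + u\<close> differ by \<open>r / 2 * norm s\<close>.\<close>
      define u where "u = (r / 2 / norm s) *\<^sub>R s"
      have "norm u = r / 2"
        using False \<open>0 < r\<close> by (simp add: u_def)
      then have "g \<in> F n" "g + u \<in> F n"
        using ball \<open>0 < r\<close> by (auto simp: subset_iff dist_norm)
      then have "norm (cinner s g) \<le> n" "norm (cinner s (g + u)) \<le> n"
        using \<open>s \<in> S\<close> by (auto simp: F_def)
      moreover have "cinner s u = cinner s (g + u) - cinner s g"
        by (simp add: cinner_add_right)
      ultimately have "norm (cinner s u) \<le> 2 * real n"
        using norm_triangle_ineq4[of "cinner s (g + u)" "cinner s g"] by simp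
      moreover have "cinner s u = complex_of_real (r / 2 * norm s)"
        using False
        by (simp add: u_def scaleR_scaleC cinner_scaleC_right cinner_self power2_eq_square)
      ultimately have "r / 2 * norm s \<le> 2 * real n"
        using \<open>0 < r\<close> by (simp only: norm_of_real)
      then show ?thesis
        using \<open>0 < r\<close> by (simp add: field_simps)
    qed (use \<open>0 < r\<close> in simp)
  qed
qed

text \<open>Homogeneity: rescale \<open>x\<close> so that \<open>norm (a x)\<close> becomes
  \<open>\<delta>\<close>. As \<open>a\<close> may have a kernel, the case \<open>a x = 0\<close> is
  separate: every multiple of \<open>x\<close> then obeys the local bound, which forces
  \<open>T x = 0\<close>.\<close>

lemma clinear_bound_of_local_bound:
  fixes a :: "'e::complex_vector \<Rightarrow> 'h::complex_inner" and T :: "'e \<Rightarrow> 'k::complex_inner"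
  assumes a: "clinear a" and T: "clinear T" and "0 < \<delta>"
    and bound: "\<And>x. norm (a x) \<le> \<delta> \<Longrightarrow> norm (T x) \<le> c"
  shows "norm (T x) \<le> c / \<delta> * norm (a x)"
proof (cases "a x = 0")
  case True
  have "T x = 0"
  proof (rule ccontr)
    assume "T x \<noteq> 0"
    define r where "r = (\<bar>c\<bar> + 1) / norm (T x)"
    have "norm (T (r *\<^sub>R x)) \<le> c"
      using True \<open>0 < \<delta>\<close> by (intro bound) (simp add: clinear_scaleR[OF a])
    moreover have "norm (T (r *\<^sub>R x)) = \<bar>c\<bar> + 1"
      using \<open>T x \<noteq> 0\<close> by (simp add: clinear_scaleR[OF T] r_def)
    ultimately show False
      by simp
  qed
  then show ?thesis
    using True by simp
next
  case False
  define r where "r = \<delta> / norm (a x)"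
  have "norm (T (r *\<^sub>R x)) \<le> c"
    using False \<open>0 < \<delta>\<close> by (intro bound) (simp add: clinear_scaleR[OF a] r_def)
  then show ?thesis
    using False \<open>0 < \<delta>\<close> by (simp add: clinear_scaleR[OF T] r_def field_simps)
qed

section \<open>Weak topologies\<close>

lemma topspace_weak_topology:
  assumes "\<Phi> \<noteq> {}"
  shows "topspace (weak_topology \<Phi>) = UNIV"
proof -
  obtain \<phi> where "\<phi> \<in> \<Phi>"
    using assms by blast
  then have "\<phi> -` UNIV \<in> {\<phi> -` U |\<phi> U. \<phi> \<in> \<Phi> \<and> open U}"
    using open_UNIV by blast
  then show ?thesis
    unfolding weak_topology_def topology_generated_by_topspace by auto
qed

lemma continuous_map_weak_functional:
  assumes "\<phi> \<in> \<Phi>"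
  shows "continuous_map (weak_topology \<Phi>) euclidean \<phi>"
  unfolding continuous_map_alt
proof (intro conjI allI impI)
  fix U :: "complex set" assume "openin euclidean U"
  then have "openin (weak_topology \<Phi>) (\<phi> -` U)"
    unfolding weak_topology_def using assms by (intro topology_generated_by_Basis) auto
  moreover have "topspace (weak_topology \<Phi>) = UNIV"
    using assms by (intro topspace_weak_topology) auto
  ultimately show "openin (weak_topology \<Phi>) (\<phi> -` U \<inter> topspace (weak_topology \<Phi>))"
    by simp
qed simp

text \<open>Universal property of the initial topology: preimages need checking only for the
  generating sets.\<close>

lemma continuous_map_weak_topology:
  assumes "\<Phi> \<noteq> {}"
  shows "continuous_map X (weak_topology \<Phi>) g \<longleftrightarrow> (\<forall>\<phi>\<in>\<Phi>. continuous_map X euclidean (\<lambda>x. \<phi> (g x)))"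
proof safe
  fix \<phi> assume "continuous_map X (weak_topology \<Phi>) g" "\<phi> \<in> \<Phi>"
  then have "continuous_map X euclidean (\<phi> \<circ> g)"
    by (rule continuous_map_compose[OF _ continuous_map_weak_functional])
  then show "continuous_map X euclidean (\<lambda>x. \<phi> (g x))"
    by (simp add: o_def)
next
  assume *: "\<forall>\<phi>\<in>\<Phi>. continuous_map X euclidean (\<lambda>x. \<phi> (g x))"
  show "continuous_map X (weak_topology \<Phi>) g"
    unfolding weak_topology_def
  proof (rule continuous_on_generated_topo)
    fix V assume "V \<in> {\<phi> -` U |\<phi> U. \<phi> \<in> \<Phi> \<and> open U}"
    then obtain \<phi> U where V: "V = \<phi> -` U" "\<phi> \<in> \<Phi>" "open U"
      by blast
    then have "openin X ((\<lambda>x. \<phi> (g x)) -` U \<inter> topspace X)"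
      using * by (simp add: continuous_map_alt)
    then show "openin X (g -` V \<inter> topspace X)"
      by (simp add: V vimage_def)
  next
    show "g ` topspace X \<subseteq> \<Union>{\<phi> -` U |\<phi> U. \<phi> \<in> \<Phi> \<and> open U}"
      using topspace_weak_topology[OF assms]
      unfolding weak_topology_def topology_generated_by_topspace by simp
  qed
qed

lemma limitin_weak_topology:
  assumes "limitin (weak_topology \<Phi>) f l G" "\<phi> \<in> \<Phi>"
  shows "((\<lambda>n. \<phi> (f n)) \<longlongrightarrow> \<phi> l) G"
  using continuous_map_limit[OF continuous_map_weak_functional[OF assms(2)] assms(1)]
  by (simp add: o_def)

text \<open>The norm topology is finer than the weak one. Weakly continuous maps can therefore be
  tested along norm convergent sequences.\<close>

lemma continuous_map_weak_hilbert:
  "continuous_map weak_hilbert X f \<Longrightarrow> continuous_map euclidean X f"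
proof -
  assume f: "continuous_map weak_hilbert X f"
  have "continuous_map euclidean weak_hilbert id"
    unfolding weak_hilbert_def
    by (simp add: continuous_map_weak_topology
        bounded_linear.continuous_on[OF bounded_linear_cinner_left continuous_on_id])
  from continuous_map_compose[OF this f] show ?thesis
    by simp
qed

section \<open>Positive operators and their Hilbert completions\<close>

locale dual_pairing =
  fixes p :: "'f::complex_vector \<Rightarrow> 'e::complex_vector \<Rightarrow> complex"
  assumes anti_dual_pair: "anti_dual_pair p"
begin

lemma clinear_pairing: "clinear (\<lambda>f. p f x)"
  using anti_dual_pair by (simp add: anti_dual_pair_def)

lemma pairing_add_left: "p (f + g) x = p f x + p g x"
  and pairing_diff_left: "p (f - g) x = p f x - p g x"
  and pairing_zero_left: "p 0 x = 0"
  and pairing_scaleC_left: "p (c *\<^sub>C f) x = c * p f x"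
  using clinear_add[OF clinear_pairing] clinear_diff[OF clinear_pairing]
    clinear_scaleC[OF clinear_pairing] clinear_0[OF clinear_pairing]
  by (simp_all add: scaleC_complex_def)

lemma pairing_add_right: "p f (x + y) = p f x + p f y"
  and pairing_scaleC_right: "p f (c *\<^sub>C x) = cnj c * p f x"
  using anti_dual_pair by (simp_all add: anti_dual_pair_def)

lemma pairing_ext: "(\<And>x. p f x = p g x) \<Longrightarrow> f = g"
  using anti_dual_pair pairing_diff_left[of f g] unfolding anti_dual_pair_def
  by (metis eq_iff_diff_eq_0)

lemma clinearI_pairing:
  assumes "\<And>x. clinear (\<lambda>h. p (T h) x)"
  shows "clinear T"
  using assms unfolding clinear_complex_iff clinear_iff
  by (auto intro!: pairing_ext simp: pairing_add_left pairing_scaleC_left)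

text \<open>Induction on the generation of a weakly open set containing 0: a generating set uses a
  single functional, an intersection takes the larger index, and a union needs only one member
  containing 0.\<close>

lemma weak_star_CauchyI:
  assumes "\<And>x. Cauchy (\<lambda>n. p (f n) x)"
  shows "weak_star_Cauchy p f"
  unfolding weak_star_Cauchy_def
proof safe
  fix U assume "openin (sigma_F p) U" "0 \<in> U"
  then have "generate_topology_on {\<phi> -` V |\<phi> V. \<phi> \<in> range (\<lambda>x f. p f x) \<and> open V} U" "0 \<in> U"
    by (simp_all add: sigma_F_def weak_topology_def openin_topology_generated_by_iff)
  then show "\<exists>N. \<forall>m\<ge>N. \<forall>n\<ge>N. f m - f n \<in> U"
  proof induction
    case (Int U V)
    then obtain M N where "\<forall>m\<ge>M. \<forall>n\<ge>M. f m - f n \<in> U" "\<forall>m\<ge>N. \<forall>n\<ge>N. f m - f n \<in> V"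
      by auto
    then have "\<forall>m\<ge>max M N. \<forall>n\<ge>max M N. f m - f n \<in> U \<inter> V"
      by simp
    then show ?case
      by blast
  next
    case (UN K)
    then show ?case
      by (meson UnionE UnionI)
  next
    case (Basis U)
    then obtain x V where U: "U = (\<lambda>f. p f x) -` V" and "open V"
      by auto
    with Basis have "0 \<in> V"
      by (simp add: pairing_zero_left)
    with \<open>open V\<close> obtain e where "e > 0" "ball 0 e \<subseteq> V"
      using open_contains_ball by blast
    moreover obtain N where "\<forall>m\<ge>N. \<forall>n\<ge>N. dist (p (f m) x) (p (f n) x) < e"
      using assms \<open>e > 0\<close> unfolding Cauchy_def by blast
    ultimately have "\<forall>m\<ge>N. \<forall>n\<ge>N. f m - f n \<in> U"
      by (auto simp: U pairing_diff_left dist_norm subset_iff)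
    then show ?case
      by blast
  qed simp
qed

section \<open>Positive operators as semi-inner products on \<open>E\<close>\<close>

context
  fixes C :: "'e \<Rightarrow> 'f"
  assumes C: "positive_op p C"
begin

lemma positive_op_clinear: "clinear C"
  using C by (simp add: positive_op_def)

lemma positive_op_form_add_left: "p (C (x + y)) z = p (C x) z + p (C y) z"
  and positive_op_form_scaleC_left: "p (C (c *\<^sub>C x)) z = c * p (C x) z"
  by (simp_all add: clinear_add[OF positive_op_clinear] clinear_scaleC[OF positive_op_clinear]
      pairing_add_left pairing_scaleC_left)

lemmas form_simps = positive_op_form_add_left positive_op_form_scaleC_left
  pairing_add_right pairing_scaleC_right

lemma positive_op_Re_ge_0: "0 \<le> Re (p (C x) x)"
  and positive_op_Im_eq_0: "Im (p (C x) x) = 0"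
  using C by (simp_all add: positive_op_def complex_nonneg_Reals_iff)

text \<open>Polarisation: the form is real at \<open>x + y\<close> and at
  \<open>x + \<i> *\<^sub>C y\<close>, which fixes the imaginary and the real part of the
  identity.\<close>

lemma positive_op_hermitian: "p (C x) y = cnj (p (C y) x)"
proof -
  have "Im (p (C (x + y)) (x + y)) = 0" "Im (p (C (x + \<i> *\<^sub>C y)) (x + \<i> *\<^sub>C y)) = 0"
    by (rule positive_op_Im_eq_0)+
  then show ?thesis
    using positive_op_Im_eq_0[of x] positive_op_Im_eq_0[of y]
    by (simp add: form_simps complex_eq_iff)
qed

text \<open>By hermitian symmetry \<open>x \<mapsto> p (C x) y\<close> is the conjugate of
  \<open>x \<mapsto> p (C y) x\<close>, one of the functionals that define
  \<open>sigma_E p\<close>.\<close>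

lemma positive_op_weak_ops: "C \<in> weak_ops p"
proof -
  have "continuous_map (sigma_E p) euclidean (\<lambda>x. p (C y) x)" for y
    unfolding sigma_E_def by (rule continuous_map_weak_functional) simp
  then have "continuous_map (sigma_E p) euclidean (\<lambda>x. cnj (p (C y) x))" for y
    using continuous_map_compose[of "sigma_E p" euclidean "\<lambda>x. p (C y) x" euclidean cnj]
    by (simp add: o_def continuous_intros)
  then have "continuous_map (sigma_E p) euclidean (\<lambda>x. p (C x) y)" for y
    by (subst positive_op_hermitian)
  then show ?thesis
    unfolding weak_ops_def sigma_F_def
    by (simp add: positive_op_clinear continuous_map_weak_topology)
qed

lemma positive_op_quadratic:
  "Re (p (C (x + c *\<^sub>C y)) (x + c *\<^sub>C y))
    = Re (p (C x) x) + 2 * Re (cnj c * p (C x) y) + (norm c)\<^sup>2 * Re (p (C y) y)"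
proof -
  have "Re (c * p (C y) x) = Re (cnj c * p (C x) y)"
    by (subst positive_op_hermitian) simp
  moreover have "Re (c * (cnj c * p (C y) y)) = (norm c)\<^sup>2 * Re (p (C y) y)"
    unfolding cmod_power2 by (simp add: algebra_simps power2_eq_square)
  moreover have "p (C (x + c *\<^sub>C y)) (x + c *\<^sub>C y)
      = p (C x) x + cnj c * p (C x) y + c * p (C y) x + c * (cnj c * p (C y) y)"
    by (simp add: form_simps algebra_simps)
  ultimately show ?thesis
    by (simp only: plus_complex.sel)
qed

lemma positive_op_cauchy_schwarz:
  "(norm (p (C x) y))\<^sup>2 \<le> Re (p (C x) x) * Re (p (C y) y)"
proof -
  define b where "b = (norm (p (C x) y))\<^sup>2"
  have quad: "0 \<le> Re (p (C x) x) - 2 * t * b + t\<^sup>2 * b * Re (p (C y) y)" for t :: real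
  proof -
    \<comment> \<open>This direction makes the cross term \<open>- 2 * t * b\<close>, leaving a
      quadratic polynomial in the real variable \<open>t\<close>.\<close>
    define c where "c = - complex_of_real t * p (C x) y"
    have "Re (cnj c * p (C x) y) = - t * b"
      unfolding b_def cmod_power2 by (simp add: c_def algebra_simps power2_eq_square)
    moreover have "(norm c)\<^sup>2 = t\<^sup>2 * b"
      by (simp add: c_def b_def norm_mult power_mult_distrib)
    ultimately show ?thesis
      using positive_op_quadratic[of x c y] positive_op_Re_ge_0[of "x + c *\<^sub>C y"] by simp
  qed
  show ?thesis
  proof (cases "Re (p (C y) y) = 0")
    case True
    have "b = 0"
    proof (rule ccontr)
      assume "b \<noteq> 0"
      \<comment> \<open>The polynomial is affine in \<open>t\<close> here and takes the value -1 at
        the chosen point.\<close>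
      then show False
        using quad[of "(Re (p (C x) x) + 1) / (2 * b)"] True by simp
    qed
    then show ?thesis
      using True by (simp add: b_def)
  next
    case False
    then have "0 < Re (p (C y) y)"
      using positive_op_Re_ge_0[of y] by simp
    \<comment> \<open>The minimum over \<open>t\<close> is attained at the reciprocal of the form at
      \<open>y\<close>.\<close>
    then show ?thesis
      using quad[of "1 / Re (p (C y) y)"] unfolding b_def[symmetric]
      by (simp add: power2_eq_square field_simps)
  qed
qed

lemma positive_op_sqrt_triangle:
  "sqrt (Re (p (C (x + y)) (x + y))) \<le> sqrt (Re (p (C x) x)) + sqrt (Re (p (C y) y))"
proof (rule real_le_lsqrt)
  have "Re (p (C x) y) \<le> sqrt (Re (p (C x) x) * Re (p (C y) y))"
    using positive_op_cauchy_schwarz[of x y] complex_Re_le_cmod[of "p (C x) y"]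
    by (meson order_trans real_le_rsqrt)
  then show "Re (p (C (x + y)) (x + y)) \<le> (sqrt (Re (p (C x) x)) + sqrt (Re (p (C y) y)))\<^sup>2"
    using positive_op_quadratic[of x 1 y] positive_op_Re_ge_0
    by (simp add: scaleC_one power2_sum real_sqrt_mult)
qed (simp add: positive_op_Re_ge_0)

end

lemma positive_op_form_eqI:
  assumes "clinear C" "\<And>x. p (C x) x = complex_of_real ((norm (a x))\<^sup>2)"
  shows "positive_op p C"
  using assms by (simp add: positive_op_def del: of_real_power)

text \<open>Both forms are real on the diagonal, so the operator order is decided by real parts
  alone.\<close>

lemma le_opI:
  assumes "positive_op p C" "positive_op p D" "\<And>x. Re (p (C x) x) \<le> Re (p (D x) x)"
  shows "le_op p C D"
  using assms positive_op_Im_eq_0[OF assms(1)] positive_op_Im_eq_0[OF assms(2)]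
  unfolding le_op_def
  by (auto simp: positive_op_def clinear_iff pairing_diff_left complex_nonneg_Reals_iff
      complex_vector.scale_right_diff_distrib)

lemma le_opD: "le_op p C D \<Longrightarrow> Re (p (C x) x) \<le> Re (p (D x) x)"
  by (simp add: le_op_def positive_op_def pairing_diff_left complex_nonneg_Reals_iff)

lemma positive_op_scaleC:
  assumes "positive_op p C" "0 \<le> r"
  shows "positive_op p (\<lambda>x. complex_of_real r *\<^sub>C C x)"
  using assms
  by (simp add: positive_op_def clinear_iff complex_nonneg_Reals_iff pairing_scaleC_left
      complex_vector.scale_right_distrib complex_vector.scale_left_commute)

end

section \<open>The Hilbert completion of \<open>range A\<close> and the operator
  \<open>J\<close>\<close>

locale positive_completion = dual_pairing p
  for p :: "'f::complex_vector \<Rightarrow> 'e::complex_vector \<Rightarrow> complex" +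
  fixes A :: "'e \<Rightarrow> 'f" and \<iota> :: "'f \<Rightarrow> 'h::chilbert_space"
  assumes seq_complete: "weak_star_seq_complete p"
    and positive: "positive_op p A"
    and completion: "hilbert_completion p A \<iota>"
begin

text \<open>Taken on all of \<open>E\<close>, so that no membership in \<open>range A\<close> has to
  be carried along; \<open>J_adj_eq\<close> identifies it with the adjoint of
  \<open>J\<close>.\<close>

definition emb :: "'e \<Rightarrow> 'h" where
  "emb x = \<iota> (A x)"

abbreviation J :: "'h \<Rightarrow> 'f" where
  "J \<equiv> J_op p A \<iota>"

lemma clinear_emb: "clinear emb"
  using completion positive
  by (simp add: hilbert_completion_def emb_def clinear_iff positive_op_def)

lemma cinner_emb: "cinner (emb x) (emb y) = p (A x) y"
  using completion by (simp add: hilbert_completion_def emb_def)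

lemma Re_form: "Re (p (A x) x) = (norm (emb x))\<^sup>2"
  by (simp add: cinner_emb[symmetric] cinner_self del: of_real_power)

lemma dense_emb: "closure (range emb) = UNIV"
  using completion by (simp add: hilbert_completion_def emb_def image_image)

lemma dense_embE:
  obtains x where "(\<lambda>n. emb (x n)) \<longlonglongrightarrow> h"
proof -
  have "h \<in> closure (range emb)"
    by (simp add: dense_emb)
  then obtain g where "\<And>n. g n \<in> range emb" "g \<longlonglongrightarrow> h"
    by (auto simp: closure_sequential)
  then obtain x where "g = (\<lambda>n. emb (x n))"
    unfolding image_iff fun_eq_iff by metis
  with \<open>g \<longlonglongrightarrow> h\<close> show thesis
    using that[of x] by simp
qed

lemma orthogonal_emb_eq_0:
  assumes "\<And>x. cinner (emb x) h = 0"
  shows "h = 0"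
proof -
  obtain x where "(\<lambda>n. emb (x n)) \<longlonglongrightarrow> h"
    by (rule dense_embE)
  then have "(\<lambda>n. cinner (emb (x n)) h) \<longlonglongrightarrow> cinner h h"
    by (rule tendsto_cinner_left)
  then have "cinner h h = 0"
    using assms by (simp add: LIMSEQ_const_iff)
  then show ?thesis
    by simp
qed

text \<open>Sequential completeness enters here: if \<open>emb (y n)\<close> tends to
  \<open>h\<close>, then \<open>A (y n)\<close> is weak-* Cauchy, and its limit is the value of
  \<open>J\<close> at \<open>h\<close>.\<close>

lemma J_exists: "\<exists>f. \<forall>x. p f x = cinner h (emb x)"
proof -
  obtain y where y: "(\<lambda>n. emb (y n)) \<longlonglongrightarrow> h"
    by (rule dense_embE)
  have lim: "(\<lambda>n. p (A (y n)) x) \<longlonglongrightarrow> cinner h (emb x)" for x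
    using tendsto_cinner_left[OF y, of "emb x"] by (simp add: cinner_emb)
  then have "weak_star_Cauchy p (\<lambda>n. A (y n))"
    by (intro weak_star_CauchyI LIMSEQ_imp_Cauchy)
  then obtain f where "limitin (sigma_F p) (\<lambda>n. A (y n)) f sequentially"
    using seq_complete by (auto simp: weak_star_seq_complete_def)
  then have "(\<lambda>n. p (A (y n)) x) \<longlonglongrightarrow> p f x" for x
    unfolding sigma_F_def by (rule limitin_weak_topology) simp
  then show ?thesis
    using lim LIMSEQ_unique by blast
qed

text \<open>Justifies the definite description in \<open>J_op\<close>. The vectors of
  \<open>J_exists\<close> form a suitable map, and two suitable maps agree on the dense range of
  \<open>emb\<close>, hence everywhere by continuity.\<close>

lemma J_spec:
  "clinear J \<and> continuous_map weak_hilbert (sigma_F p) J \<and> (\<forall>f\<in>range A. J (\<iota> f) = f)"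
proof -
  let ?P = "\<lambda>T. clinear T \<and> continuous_map weak_hilbert (sigma_F p) T \<and> (\<forall>f\<in>range A. T (\<iota> f) = f)"
  obtain T where T: "\<And>h x. p (T h) x = cinner h (emb x)"
    using J_exists by metis
  have "continuous_map weak_hilbert euclidean (\<lambda>h. cinner h k)" for k :: 'h
    unfolding weak_hilbert_def by (rule continuous_map_weak_functional) simp
  then have "?P T"
    by (auto intro!: clinearI_pairing pairing_ext simp: T clinear_cinner_left sigma_F_def
        continuous_map_weak_topology cinner_emb[unfolded emb_def] emb_def)
  moreover have "T1 = T2" if "?P T1" "?P T2" for T1 T2
  proof (intro ext pairing_ext)
    fix h x
    obtain y where y: "(\<lambda>n. emb (y n)) \<longlonglongrightarrow> h"
      by (rule dense_embE)
    have lim: "(\<lambda>n. p (T (emb (y n))) x) \<longlonglongrightarrow> p (T h) x" if "?P T" for T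
    proof -
      have "continuous_map euclidean (sigma_F p) T"
        using that by (blast intro: continuous_map_weak_hilbert)
      then have "continuous_on UNIV (\<lambda>h. p (T h) x)"
        by (simp add: sigma_F_def continuous_map_weak_topology)
      then show ?thesis
        using y by (auto intro: continuous_on_tendsto_compose)
    qed
    have "(\<lambda>n. p (T1 (emb (y n))) x) = (\<lambda>n. p (T2 (emb (y n))) x)"
      using that by (simp add: emb_def)
    then show "p (T1 h) x = p (T2 h) x"
      using lim[OF that(1)] lim[OF that(2)] LIMSEQ_unique by metis
  qed
  ultimately have "\<exists>!T. ?P T"
    by blast
  from theI'[OF this] show ?thesis
    unfolding J_op_def .
qed

text \<open>Both sides are norm continuous in \<open>h\<close> and agree on the range of
  \<open>emb\<close>. All later computations with \<open>J\<close> go through this identity.\<close>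

lemma pairing_J: "p (J h) x = cinner h (emb x)"
proof -
  obtain y where y: "(\<lambda>n. emb (y n)) \<longlonglongrightarrow> h"
    by (rule dense_embE)
  have "continuous_map euclidean (sigma_F p) J"
    using J_spec by (blast intro: continuous_map_weak_hilbert)
  then have "continuous_on UNIV (\<lambda>h. p (J h) x)"
    by (simp add: sigma_F_def continuous_map_weak_topology)
  then have "(\<lambda>n. p (J (emb (y n))) x) \<longlonglongrightarrow> p (J h) x"
    using y by (auto intro: continuous_on_tendsto_compose)
  moreover have "p (J (emb z)) x = cinner (emb z) (emb x)" for z
    using J_spec by (simp add: cinner_emb) (simp add: emb_def)
  ultimately show ?thesis
    using LIMSEQ_unique[OF _ tendsto_cinner_left[OF y]] by simp
qed

lemma clinear_J: "clinear J"
  using J_spec by blast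

lemma J_adj_eq: "J_adj p A \<iota> x = emb x"
  unfolding J_adj_def pairing_J by (rule the_equality, simp, rule cinner_ext, simp)

end

section \<open>Lebesgue decompositions of a pair of positive operators\<close>

locale positive_pair =
  A: positive_completion p A \<iota>A + B: positive_completion p B \<iota>B
  for p :: "'f::complex_vector \<Rightarrow> 'e::complex_vector \<Rightarrow> complex"
    and A B :: "'e \<Rightarrow> 'f"
    and \<iota>A :: "'f \<Rightarrow> 'h::chilbert_space"
    and \<iota>B :: "'f \<Rightarrow> 'k::chilbert_space"
begin

section \<open>The closed relation and its multivalued part\<close>

abbreviation R :: "('h \<times> 'k) set" where
  "R \<equiv> B_hat A \<iota>A B \<iota>B"

abbreviation M :: "'k set" where
  "M \<equiv> mul_part R"

abbreviation D :: "'k set" where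
  "D \<equiv> Domain (rel_adjoint R)"

lemma R_eq: "R = closure (range (\<lambda>x. (A.emb x, B.emb x)))"
  by (simp add: B_hat_def A.emb_def B.emb_def)

lemma emb_in_R: "(A.emb x, B.emb x) \<in> R"
  unfolding R_eq by (rule subsetD[OF closure_subset]) simp

lemma R_sequence:
  assumes "(h, k) \<in> R"
  obtains x where "(\<lambda>n. A.emb (x n)) \<longlonglongrightarrow> h" "(\<lambda>n. B.emb (x n)) \<longlonglongrightarrow> k"
proof -
  obtain g where "\<And>n. g n \<in> range (\<lambda>x. (A.emb x, B.emb x))" "g \<longlonglongrightarrow> (h, k)"
    using assms by (auto simp: R_eq closure_sequential)
  then have "\<forall>n. \<exists>x. g n = (A.emb x, B.emb x)"
    by auto
  then obtain x where "g = (\<lambda>n. (A.emb (x n), B.emb (x n)))"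
    unfolding fun_eq_iff by metis
  with \<open>g \<longlonglongrightarrow> (h, k)\<close> have "(\<lambda>n. (A.emb (x n), B.emb (x n))) \<longlonglongrightarrow> (h, k)"
    by simp
  from tendsto_fst[OF this] tendsto_snd[OF this] show thesis
    by (intro that[of x]) simp_all
qed

lemma R_limit:
  assumes "(\<lambda>n. A.emb (x n)) \<longlonglongrightarrow> h" "(\<lambda>n. B.emb (x n)) \<longlonglongrightarrow> k"
  shows "(h, k) \<in> R"
  unfolding R_eq closure_sequential
  by (rule exI[of _ "\<lambda>n. (A.emb (x n), B.emb (x n))"]) (simp add: tendsto_Pair assms)

lemma closed_R: "closed R"
  by (simp add: R_eq)

lemma R_add:
  assumes "(h, k) \<in> R" "(h', k') \<in> R"
  shows "(h + h', k + k') \<in> R"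
proof -
  obtain x where x: "(\<lambda>n. A.emb (x n)) \<longlonglongrightarrow> h" "(\<lambda>n. B.emb (x n)) \<longlonglongrightarrow> k"
    using assms(1) by (rule R_sequence)
  obtain y where y: "(\<lambda>n. A.emb (y n)) \<longlonglongrightarrow> h'" "(\<lambda>n. B.emb (y n)) \<longlonglongrightarrow> k'"
    using assms(2) by (rule R_sequence)
  show ?thesis
    using tendsto_add[OF x(1) y(1)] tendsto_add[OF x(2) y(2)]
    by (intro R_limit[of "\<lambda>n. x n + y n"])
      (simp_all add: clinear_add[OF A.clinear_emb] clinear_add[OF B.clinear_emb])
qed

lemma R_scaleC:
  assumes "(h, k) \<in> R"
  shows "(c *\<^sub>C h, c *\<^sub>C k) \<in> R"
proof -
  obtain x where x: "(\<lambda>n. A.emb (x n)) \<longlonglongrightarrow> h" "(\<lambda>n. B.emb (x n)) \<longlonglongrightarrow> k"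
    using assms by (rule R_sequence)
  show ?thesis
    by (rule R_limit[of "\<lambda>n. c *\<^sub>C x n"])
      (simp_all add: clinear_scaleC[OF A.clinear_emb] clinear_scaleC[OF B.clinear_emb]
        bounded_linear.tendsto[OF bounded_linear_scaleC] x)
qed

lemma R_zero: "(0, 0) \<in> R"
  using emb_in_R[of 0] by (simp add: clinear_0[OF A.clinear_emb] clinear_0[OF B.clinear_emb])

lemma R_diff: "(h, k) \<in> R \<Longrightarrow> (h', k') \<in> R \<Longrightarrow> (h - h', k - k') \<in> R"
  using R_add[of h k "(-1) *\<^sub>C h'" "(-1) *\<^sub>C k'"] R_scaleC[of h' k' "-1"]
  by (simp add: complex_vector.scale_minus_left complex_vector.scale_one)

lemma subspace_R: "subspace R"
  using R_zero R_add R_scaleC by (auto simp: subspace_def scaleR_scaleC zero_prod_def)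

sublocale M: closed_csubspace M
proof
  show "complex_vector.subspace M"
    using R_zero R_add[of 0 _ 0] R_scaleC[of 0]
    by (auto simp: complex_vector.subspace_def mul_part_def)
  have "closed ((\<lambda>\<xi>. (0, \<xi>)) -` R)"
    by (intro continuous_closed_vimage closed_R) (auto intro!: continuous_intros)
  then show "closed M"
    by (simp add: mul_part_def vimage_def)
qed

sublocale MC: closed_csubspace "orth_compl M"
  by (rule closed_csubspace_orth_compl)

section \<open>The domain of the adjoint relation\<close>

lemma D_iff: "g \<in> D \<longleftrightarrow> (\<exists>f. \<forall>x. cinner (B.emb x) g = cinner (A.emb x) f)"
proof -
  have "(g, f) \<in> rel_adjoint R \<longleftrightarrow> (\<forall>x. cinner (B.emb x) g = cinner (A.emb x) f)" for f
  proof
    assume "(g, f) \<in> rel_adjoint R"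
    then show "\<forall>x. cinner (B.emb x) g = cinner (A.emb x) f"
      using emb_in_R by (auto simp: rel_adjoint_def)
  next
    assume *: "\<forall>x. cinner (B.emb x) g = cinner (A.emb x) f"
    \<comment> \<open>The identity holds on the pairs \<open>(A.emb x, B.emb x)\<close> and passes
      to limits.\<close>
    have "cinner k g = cinner h f" if "(h, k) \<in> R" for h k
    proof -
      obtain x where "(\<lambda>n. A.emb (x n)) \<longlonglongrightarrow> h" "(\<lambda>n. B.emb (x n)) \<longlonglongrightarrow> k"
        using \<open>(h, k) \<in> R\<close> by (rule R_sequence)
      from tendsto_cinner_left[OF this(1), of f] tendsto_cinner_left[OF this(2), of g]
      show ?thesis
        using * LIMSEQ_unique by simp blast
    qed
    then show "(g, f) \<in> rel_adjoint R"
      by (auto simp: rel_adjoint_def)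
  qed
  then show ?thesis
    by auto
qed

lemma csubspace_D: "complex_vector.subspace D"
  unfolding complex_vector.subspace_def
proof (intro conjI allI ballI)
  show "0 \<in> D"
    unfolding D_iff by (rule exI[of _ 0]) simp
  show "g + g' \<in> D" if "g \<in> D" "g' \<in> D" for g g'
    using that unfolding D_iff cinner_add_right by (metis cinner_add_right)
  show "c *\<^sub>C g \<in> D" if "g \<in> D" for c g
    using that unfolding D_iff cinner_scaleC_right by (metis cinner_scaleC_right)
qed

lemma D_subset: "D \<subseteq> orth_compl M"
proof
  fix g assume "g \<in> D"
  then obtain f where "\<forall>(h, k)\<in>R. cinner k g = cinner h f"
    by (auto simp: rel_adjoint_def)
  then have "cinner m g = 0" if "m \<in> M" for m
    using that by (auto simp: mul_part_def)
  then show "g \<in> orth_compl M"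
    using cinner_eq_0_commute by (auto simp: orth_compl_def)
qed

text \<open>This gives the density of \<open>D\<close> in \<open>orth_compl M\<close>. Projecting
  \<open>(0, \<xi>)\<close> onto \<open>R\<close> leaves the residual
  \<open>(- h, \<xi> - k)\<close>, orthogonal to \<open>R\<close>, so that \<open>\<xi> - k\<close>
  belongs to \<open>D\<close> and is orthogonal to \<open>\<xi>\<close>. Then
  \<open>\<xi> - k\<close> and \<open>h\<close> have squared norms with sum 0.\<close>

lemma orth_compl_D_subset: "orth_compl D \<subseteq> M"
proof
  fix \<xi> assume \<xi>: "\<xi> \<in> orth_compl D"
  obtain m where m: "m \<in> R" "\<And>s. s \<in> R \<Longrightarrow> inner ((0, \<xi>) - m) s = 0"
    using closed_subspace_projection[OF subspace_R closed_R, where x = "(0, \<xi>)"] by blast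
  obtain h k where hk: "m = (h, k)"
    by (cases m)
  have eq: "inner (\<xi> - k) v = inner h u" if "(u, v) \<in> R" for u v
    using m(2)[OF that] by (simp add: hk inner_diff_left)
  \<comment> \<open>The projection yields only real orthogonality; using it at \<open>x\<close> and
    at \<open>\<i> *\<^sub>C x\<close> recovers the complex identity.\<close>
  have "cinner (B.emb x) (\<xi> - k) = cinner (A.emb x) h" for x
  proof -
    have "Re (cinner (B.emb y) (\<xi> - k)) = Re (cinner (A.emb y) h)" for y
      using eq[OF emb_in_R[of y]] by (metis inner_commute inner_eq_Re_cinner)
    from this[of x] this[of "\<i> *\<^sub>C x"] show ?thesis
      by (simp add: clinear_scaleC[OF A.clinear_emb] clinear_scaleC[OF B.clinear_emb]
          cinner_scaleC_left complex_eq_iff)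
  qed
  then have "\<xi> - k \<in> D"
    unfolding D_iff by blast
  with \<xi> have "inner \<xi> (\<xi> - k) = 0"
    by (simp add: orth_compl_def inner_eq_Re_cinner)
  then have "inner (\<xi> - k) \<xi> = 0"
    by (metis inner_commute)
  moreover have "inner (\<xi> - k) k = inner h h"
    using eq[of h k] m(1) hk by simp
  ultimately have "inner (\<xi> - k) (\<xi> - k) + inner h h = 0"
    by (simp add: inner_diff_right)
  then have "\<xi> = k" "h = 0"
    using inner_ge_zero[of "\<xi> - k"] inner_ge_zero[of h]
    by (metis add_nonneg_eq_0_iff inner_eq_zero_iff right_minus_eq)+
  then show "\<xi> \<in> M"
    using m(1) hk by (simp add: mul_part_def)
qed

text \<open>As \<open>D\<close> is a dense subspace of the closed space \<open>orth_compl M\<close>,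
  it is closed exactly when it is all of it.\<close>

lemma closed_D_iff: "closed D \<longleftrightarrow> orth_compl M \<subseteq> D"
proof
  assume "closed D"
  then interpret D: closed_csubspace D
    by unfold_locales (rule csubspace_D)
  have "M \<subseteq> orth_compl D"
    using D_subset cinner_eq_0_commute unfolding orth_compl_def by blast
  then have "orth_compl D = M"
    using orth_compl_D_subset by blast
  then show "orth_compl M \<subseteq> D"
    using D.orth_compl_orth_compl by simp
next
  assume "orth_compl M \<subseteq> D"
  then have "D = orth_compl M"
    using D_subset by blast
  then show "closed D"
    by (metis closed_orth_compl)
qed

text \<open>Paired with all \<open>x\<close>, the equation \<open>B.J g = A.J f\<close> becomes, up
  to conjugation, the identity that puts \<open>g\<close> into \<open>D\<close> with witness
  \<open>f\<close>.\<close>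

lemma J_image_iff: "B.J ` orth_compl M \<subseteq> range A.J \<longleftrightarrow> orth_compl M \<subseteq> D"
proof -
  have "B.J g \<in> range A.J \<longleftrightarrow> g \<in> D" for g
  proof -
    have "B.J g = A.J f \<longleftrightarrow> (\<forall>x. cinner g (B.emb x) = cinner f (A.emb x))" for f
      using A.pairing_ext A.pairing_J B.pairing_J by metis
    moreover have "cinner g (B.emb x) = cinner f (A.emb x)
        \<longleftrightarrow> cinner (B.emb x) g = cinner (A.emb x) f" for f x
      by (metis cinner_commute)
    ultimately show ?thesis
      unfolding D_iff image_iff by simp
  qed
  then show ?thesis
    by blast
qed

section \<open>Boundedness of the regular part\<close>

lemma clinear_reg: "clinear (\<lambda>x. orth_proj (orth_compl M) (B.emb x))"
  by (rule clinear_comp[OF B.clinear_emb MC.clinear_orth_proj])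

definition reg_bounded :: bool where
  "reg_bounded \<longleftrightarrow> (\<exists>c. \<forall>x. norm (orth_proj (orth_compl M) (B.emb x)) \<le> c * norm (A.emb x))"

text \<open>From left to right, the bound makes \<open>x \<mapsto> cinner (B.emb x) g\<close>
  representable through \<open>A.emb\<close>. Conversely, if every projected \<open>g\<close> lies
  in \<open>D\<close>, the set \<open>S\<close> of regular parts over the unit ball of
  \<open>A.emb\<close> is weakly bounded, hence bounded.\<close>

lemma reg_bounded_iff: "reg_bounded \<longleftrightarrow> orth_compl M \<subseteq> D"
proof
  assume "reg_bounded"
  then obtain c where c: "\<And>x. norm (orth_proj (orth_compl M) (B.emb x)) \<le> c * norm (A.emb x)"
    by (auto simp: reg_bounded_def)
  show "orth_compl M \<subseteq> D"
  proof
    fix g assume "g \<in> orth_compl M"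
    then have eq: "cinner (B.emb x) g = cinner (orth_proj (orth_compl M) (B.emb x)) g" for x
      by (simp add: MC.cinner_orth_proj MC.orth_proj_id)
    have bound: "norm (cinner (B.emb x) g) \<le> (norm g * c) * norm (A.emb x)" for x
    proof -
      have "norm (cinner (B.emb x) g) \<le> norm (orth_proj (orth_compl M) (B.emb x)) * norm g"
        unfolding eq by (rule norm_cinner_le)
      also have "\<dots> \<le> (c * norm (A.emb x)) * norm g"
        by (intro mult_right_mono c) simp
      finally show ?thesis
        by (simp add: mult_ac)
    qed
    obtain f where "\<And>x. cinner (B.emb x) g = cinner (A.emb x) f"
      using riesz_along_clinear[OF A.clinear_emb clinear_comp[OF B.clinear_emb clinear_cinner_left] bound]
      by blast
    then show "g \<in> D"
      unfolding D_iff by blast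
  qed
next
  assume sub: "orth_compl M \<subseteq> D"
  define S where "S = (\<lambda>x. orth_proj (orth_compl M) (B.emb x)) ` {x. norm (A.emb x) \<le> 1}"
  have "\<exists>c. \<forall>s\<in>S. norm (cinner s g) \<le> c" for g
  proof -
    have "orth_proj (orth_compl M) g \<in> D"
      using sub MC.orth_proj(1) by blast
    then obtain f where f: "\<And>x. cinner (B.emb x) (orth_proj (orth_compl M) g) = cinner (A.emb x) f"
      unfolding D_iff by blast
    have "norm (cinner (orth_proj (orth_compl M) (B.emb x)) g) \<le> norm f" if "norm (A.emb x) \<le> 1" for x
    proof -
      have "norm (cinner (orth_proj (orth_compl M) (B.emb x)) g) \<le> norm (A.emb x) * norm f"
        unfolding MC.cinner_orth_proj f by (rule norm_cinner_le)
      also have "\<dots> \<le> 1 * norm f"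
        using that by (intro mult_right_mono) simp_all
      finally show ?thesis
        by simp
    qed
    then show ?thesis
      by (auto simp: S_def)
  qed
  then obtain c where c: "\<And>s. s \<in> S \<Longrightarrow> norm s \<le> c"
    using weakly_bounded_imp_norm_bounded by metis
  have "norm (orth_proj (orth_compl M) (B.emb x)) \<le> c / 1 * norm (A.emb x)" for x
    by (rule clinear_bound_of_local_bound[OF A.clinear_emb clinear_reg])
      (auto intro: c simp: S_def)
  then show reg_bounded
    unfolding reg_bounded_def by blast
qed

lemma reg_part_eq: "reg_part R = {(h, orth_proj (orth_compl M) k) | h k. (h, k) \<in> R}"
  by (simp add: reg_part_def M.orth_proj_orth_compl)

text \<open>Two second components over the same \<open>h\<close> differ by an element of
  \<open>M\<close>, which the projection annihilates.\<close>

lemma graph_op_reg_part: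
  assumes "(h, k) \<in> R"
  shows "graph_op (reg_part R) h = orth_proj (orth_compl M) k"
  unfolding graph_op_def
proof (rule the_equality)
  show "(h, orth_proj (orth_compl M) k) \<in> reg_part R"
    using assms by (auto simp: reg_part_eq)
next
  fix l assume "(h, l) \<in> reg_part R"
  then obtain k' where l: "l = orth_proj (orth_compl M) k'" and "(h, k') \<in> R"
    by (auto simp: reg_part_eq)
  then have "(0, k' - k) \<in> R"
    using R_diff[OF \<open>(h, k') \<in> R\<close> assms] by simp
  then have "k' - k \<in> M"
    by (simp add: mul_part_def)
  then have "orth_proj (orth_compl M) (k' - k) = 0"
    by (simp add: M.orth_proj_orth_compl M.orth_proj_id)
  then show "l = orth_proj (orth_compl M) k"
    by (simp add: l clinear_diff[OF MC.clinear_orth_proj])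
qed

lemma continuous_reg_part_iff:
  "continuous_on (Domain (reg_part R)) (graph_op (reg_part R)) \<longleftrightarrow> reg_bounded"
proof
  assume cont: "continuous_on (Domain (reg_part R)) (graph_op (reg_part R))"
  have zero: "graph_op (reg_part R) 0 = 0"
    using graph_op_reg_part[OF R_zero] clinear_0[OF MC.clinear_orth_proj] by simp
  have dom: "h \<in> Domain (reg_part R)" if "(h, k) \<in> R" for h k
    using that by (auto simp: reg_part_eq)
  obtain d where "d > 0"
    and d: "\<And>h. h \<in> Domain (reg_part R) \<Longrightarrow> norm h < d \<Longrightarrow> norm (graph_op (reg_part R) h) < 1"
    using cont[unfolded continuous_on_iff, rule_format, of 0 1] dom[OF R_zero]
    by (auto simp: zero)
  \<comment> \<open>Half of \<open>d\<close> turns the strict inequality from continuity at 0 into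
    the non-strict local bound.\<close>
  have "norm (orth_proj (orth_compl M) (B.emb x)) \<le> 1 / (d / 2) * norm (A.emb x)" for x
  proof (rule clinear_bound_of_local_bound[OF A.clinear_emb clinear_reg])
    fix y assume "norm (A.emb y) \<le> d / 2"
    then show "norm (orth_proj (orth_compl M) (B.emb y)) \<le> 1"
      using d[OF dom[OF emb_in_R[of y]]] \<open>d > 0\<close> by (simp add: graph_op_reg_part[OF emb_in_R])
  qed (use \<open>d > 0\<close> in simp)
  then show reg_bounded
    unfolding reg_bounded_def by blast
next
  assume reg_bounded
  then obtain c where c: "\<And>x. norm (orth_proj (orth_compl M) (B.emb x)) \<le> c * norm (A.emb x)"
    by (auto simp: reg_bounded_def)
  \<comment> \<open>The estimate on the pairs \<open>(A.emb x, B.emb x)\<close> extends to their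
    closure.\<close>
  have bound: "norm (orth_proj (orth_compl M) k) \<le> c * norm h" if "(h, k) \<in> R" for h k
  proof -
    obtain x where x: "(\<lambda>n. A.emb (x n)) \<longlonglongrightarrow> h" "(\<lambda>n. B.emb (x n)) \<longlonglongrightarrow> k"
      using \<open>(h, k) \<in> R\<close> by (rule R_sequence)
    have "(\<lambda>n. norm (orth_proj (orth_compl M) (B.emb (x n)))) \<longlonglongrightarrow> norm (orth_proj (orth_compl M) k)"
      by (intro tendsto_norm bounded_linear.tendsto[OF MC.bounded_linear_orth_proj] x)
    moreover have "(\<lambda>n. c * norm (A.emb (x n))) \<longlonglongrightarrow> c * norm h"
      by (intro tendsto_intros x)
    ultimately show ?thesis
      using c by (intro LIMSEQ_le) auto
  qed
  \<comment> \<open>The absolute value is taken because \<open>c\<close> may be negative when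
    \<open>A\<close> is zero.\<close>
  have "\<bar>c\<bar>-lipschitz_on (Domain (reg_part R)) (graph_op (reg_part R))"
  proof (rule lipschitz_onI)
    fix h h' assume "h \<in> Domain (reg_part R)" "h' \<in> Domain (reg_part R)"
    then obtain k k' where "(h, k) \<in> R" "(h', k') \<in> R"
      by (auto simp: reg_part_eq)
    then have "dist (graph_op (reg_part R) h) (graph_op (reg_part R) h') \<le> c * dist h h'"
      using bound[OF R_diff, of h k h' k']
      by (simp add: graph_op_reg_part dist_norm clinear_diff[OF MC.clinear_orth_proj])
    also have "\<dots> \<le> \<bar>c\<bar> * dist h h'"
      by (intro mult_right_mono) auto
    finally show "dist (graph_op (reg_part R) h) (graph_op (reg_part R) h') \<le> \<bar>c\<bar> * dist h h'" .
  qed simp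
  then show "continuous_on (Domain (reg_part R)) (graph_op (reg_part R))"
    by (rule lipschitz_on_continuous_on)
qed

section \<open>Compressions of \<open>B\<close> to closed subspaces \<open>L\<close>, with
  \<open>B_a\<close> as the case \<open>orth_compl M\<close>\<close>

definition part :: "'k set \<Rightarrow> 'e \<Rightarrow> 'f" where
  "part L x = B.J (orth_proj L (B.emb x))"

lemma B_a_eq: "B_a p A \<iota>A B \<iota>B = part (orth_compl M)"
  by (simp add: fun_eq_iff B_a_def compress_op_def part_def B.J_adj_eq M.orth_proj_orth_compl)

lemma pairing_part: "p (part L x) y = cinner (orth_proj L (B.emb x)) (B.emb y)"
  by (simp add: part_def B.pairing_J)

lemma Re_pairing_part:
  assumes "closed_csubspace L"
  shows "Re (p (part L x) x) = (norm (orth_proj L (B.emb x)))\<^sup>2"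
  unfolding pairing_part closed_csubspace.cinner_orth_proj_orth_proj[OF assms, symmetric] cinner_self
  by (simp del: of_real_power)

lemma positive_part:
  assumes "closed_csubspace L"
  shows "positive_op p (part L)"
proof (rule A.positive_op_form_eqI)
  interpret closed_csubspace L
    by fact
  have "clinear (\<lambda>x. B.J (orth_proj L (B.emb x)))"
    by (intro clinear_comp[OF _ B.clinear_J] clinear_comp[OF _ clinear_orth_proj] B.clinear_emb)
  then show "clinear (part L)"
    by (simp add: part_def[abs_def])
  show "p (part L x) x = complex_of_real ((norm (orth_proj L (B.emb x)))\<^sup>2)" for x
    by (simp only: pairing_part cinner_orth_proj_orth_proj[symmetric] cinner_self)
qed

lemma part_add: "closed_csubspace L \<Longrightarrow> B x = part L x + part (orth_compl L) x"
  by (rule A.pairing_ext)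
    (simp add: A.pairing_add_left pairing_part closed_csubspace.orth_proj_orth_compl
      cinner_diff_left B.cinner_emb)

lemma le_op_iff:
  "(\<exists>\<alpha>::real. \<alpha> \<ge> 0 \<and> le_op p (B_a p A \<iota>A B \<iota>B) (\<lambda>x. complex_of_real \<alpha> *\<^sub>C A x))
    \<longleftrightarrow> reg_bounded"
proof
  assume "\<exists>\<alpha>::real. \<alpha> \<ge> 0 \<and> le_op p (B_a p A \<iota>A B \<iota>B) (\<lambda>x. complex_of_real \<alpha> *\<^sub>C A x)"
  then obtain \<alpha> :: real where "\<alpha> \<ge> 0"
    and le: "le_op p (part (orth_compl M)) (\<lambda>x. complex_of_real \<alpha> *\<^sub>C A x)"
    by (auto simp: B_a_eq)
  have "norm (orth_proj (orth_compl M) (B.emb x)) \<le> sqrt \<alpha> * norm (A.emb x)" for x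
  proof (rule power2_le_imp_le)
    show "(norm (orth_proj (orth_compl M) (B.emb x)))\<^sup>2 \<le> (sqrt \<alpha> * norm (A.emb x))\<^sup>2"
      using A.le_opD[OF le, of x] \<open>\<alpha> \<ge> 0\<close>
      by (simp add: Re_pairing_part[OF MC.closed_csubspace_axioms] A.pairing_scaleC_left A.Re_form
          power_mult_distrib)
  qed (use \<open>\<alpha> \<ge> 0\<close> in simp)
  then show reg_bounded
    unfolding reg_bounded_def by blast
next
  assume reg_bounded
  then obtain c where c: "\<And>x. norm (orth_proj (orth_compl M) (B.emb x)) \<le> c * norm (A.emb x)"
    by (auto simp: reg_bounded_def)
  have "le_op p (part (orth_compl M)) (\<lambda>x. complex_of_real (c\<^sup>2) *\<^sub>C A x)"
  proof (intro A.le_opI positive_part MC.closed_csubspace_axioms A.positive_op_scaleC A.positive)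
    fix x
    show "Re (p (part (orth_compl M) x) x) \<le> Re (p (complex_of_real (c\<^sup>2) *\<^sub>C A x) x)"
      using power_mono[OF c[of x], of 2]
      by (simp add: Re_pairing_part[OF MC.closed_csubspace_axioms] A.pairing_scaleC_left A.Re_form
          power_mult_distrib del: of_real_power)
  qed simp
  then show "\<exists>\<alpha>::real. \<alpha> \<ge> 0 \<and> le_op p (B_a p A \<iota>A B \<iota>B) (\<lambda>x. complex_of_real \<alpha> *\<^sub>C A x)"
    unfolding B_a_eq using zero_le_power2 by blast
qed

text \<open>The projected vectors \<open>y n\<close> converge to some \<open>k\<close> in
  \<open>L\<close>. Against \<open>d\<close> in \<open>D \<inter> L\<close> their inner products
  equal \<open>cinner (A.emb (x n)) f\<close> and tend to 0, so totality of
  \<open>D \<inter> L\<close> in \<open>L\<close> gives \<open>k = 0\<close>.\<close>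

lemma abs_cont_part:
  assumes L: "closed_csubspace L"
    and D_total: "\<And>k. k \<in> L \<Longrightarrow> (\<And>d. d \<in> D \<inter> L \<Longrightarrow> cinner k d = 0) \<Longrightarrow> k = 0"
  shows "abs_cont p A (part L)"
  unfolding abs_cont_def
proof (intro allI impI)
  interpret closed_csubspace L
    by fact
  fix x
  assume *: "(\<lambda>n. p (A (x n)) (x n)) \<longlonglongrightarrow> 0 \<and>
    ((\<lambda>(n, m). p (part L (x n - x m)) (x n - x m)) \<longlongrightarrow> 0) (sequentially \<times>\<^sub>F sequentially)"
  define y where "y n = orth_proj L (B.emb (x n))" for n
  have form: "p (part L z) z = complex_of_real ((norm (orth_proj L (B.emb z)))\<^sup>2)" for z
    by (simp only: pairing_part cinner_orth_proj_orth_proj[symmetric] cinner_self)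
  have "(\<lambda>n. sqrt (Re (p (A (x n)) (x n)))) \<longlonglongrightarrow> sqrt (Re 0)"
    using * by (intro tendsto_real_sqrt tendsto_Re) blast
  then have ax: "(\<lambda>n. A.emb (x n)) \<longlonglongrightarrow> 0"
    by (simp add: A.Re_form tendsto_norm_zero_iff)
  \<comment> \<open>The form of \<open>part L\<close> at \<open>x n - x m\<close> is the squared
    norm of \<open>y n - y m\<close>.\<close>
  have "Cauchy y"
  proof (rule metric_CauchyI)
    fix e :: real assume "e > 0"
    have "\<forall>\<^sub>F (n, m) in sequentially \<times>\<^sub>F sequentially.
        dist (p (part L (x n - x m)) (x n - x m)) 0 < e\<^sup>2"
      using * \<open>e > 0\<close> by (auto dest: tendstoD[where e = "e\<^sup>2"] simp: case_prod_unfold)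
    then obtain N where N: "\<And>m n. N \<le> m \<Longrightarrow> N \<le> n \<Longrightarrow>
        dist (p (part L (x m - x n)) (x m - x n)) 0 < e\<^sup>2"
      unfolding eventually_prod_sequentially by auto
    have "dist (y m) (y n) < e" if "m \<ge> N" "n \<ge> N" for m n
    proof -
      have "y m - y n = orth_proj L (B.emb (x m - x n))"
        by (simp add: y_def clinear_diff[OF clinear_orth_proj] clinear_diff[OF B.clinear_emb])
      then have "(norm (y m - y n))\<^sup>2 < e\<^sup>2"
        using N[OF that] by (simp add: form norm_power)
      then show ?thesis
        using \<open>e > 0\<close> by (simp add: dist_norm power_less_imp_less_base)
    qed
    then show "\<exists>N. \<forall>m\<ge>N. \<forall>n\<ge>N. dist (y m) (y n) < e"
      by blast
  qed
  then obtain k where k: "y \<longlonglongrightarrow> k"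
    using Cauchy_convergent convergent_def by blast
  have "k = 0"
  proof (rule D_total)
    show "k \<in> L"
      by (rule closed_sequentially[OF closed _ k]) (simp add: y_def orth_proj)
    fix d assume d: "d \<in> D \<inter> L"
    then obtain f where "\<And>z. cinner (B.emb z) d = cinner (A.emb z) f"
      unfolding D_iff Int_iff by blast
    then have "cinner (y n) d = cinner (A.emb (x n)) f" for n
      using d by (simp add: y_def cinner_orth_proj orth_proj_id)
    then have "(\<lambda>n. cinner (y n) d) \<longlonglongrightarrow> cinner 0 f"
      using tendsto_cinner_left[OF ax, of f] by simp
    then show "cinner k d = 0"
      using tendsto_cinner_left[OF k, of d] LIMSEQ_unique by fastforce
  qed
  then have "(\<lambda>n. complex_of_real ((norm (y n))\<^sup>2)) \<longlonglongrightarrow> complex_of_real ((norm (0::'k))\<^sup>2)"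
    using k by (intro tendsto_intros) simp
  then show "(\<lambda>n. p (part L (x n)) (x n)) \<longlonglongrightarrow> 0"
    by (simp add: form y_def)
qed

text \<open>If \<open>C\<close> lies below \<open>A\<close> and \<open>part L\<close>,
  Cauchy-Schwarz bounds \<open>z \<mapsto> p (C z) y\<close> both by \<open>A.emb z\<close> and by
  the projection of \<open>B.emb z\<close>. The two Riesz representations produce an element of
  \<open>D \<inter> L\<close>, which must vanish.\<close>

lemma singular_part:
  assumes L: "closed_csubspace L" and disjoint: "D \<inter> L \<subseteq> {0}"
  shows "singular_op p A (part L)"
  unfolding singular_op_def
proof (intro ballI impI ext A.pairing_ext)
  interpret closed_csubspace L
    by fact
  fix C x y
  assume "positive_op p C \<and> le_op p C A \<and> le_op p C (part L)"
  then have C: "positive_op p C" and CA: "le_op p C A" and CL: "le_op p C (part L)"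
    by auto
  define s where "s = sqrt (Re (p (C y) y))"
  have s: "(norm (p (C z) y))\<^sup>2 \<le> Re (p (C z) z) * s\<^sup>2" for z
    using A.positive_op_cauchy_schwarz[OF C, of z y] A.positive_op_Re_ge_0[OF C, of y]
    by (simp add: s_def)
  have bound: "norm (p (C z) y) \<le> s * r" if "Re (p (C z) z) \<le> r\<^sup>2" "0 \<le> r" for z r
  proof (rule power2_le_imp_le)
    show "(norm (p (C z) y))\<^sup>2 \<le> (s * r)\<^sup>2"
      using s[of z] mult_right_mono[OF that(1), of "s\<^sup>2"] by (simp add: power_mult_distrib mult.commute)
    show "0 \<le> s * r"
      using that(2) by (simp add: s_def A.positive_op_Re_ge_0[OF C])
  qed
  have lin: "clinear (\<lambda>z. p (C z) y)"
    by (rule clinear_comp[OF A.positive_op_clinear[OF C] A.clinear_pairing])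
  have "norm (p (C z) y) \<le> s * norm (A.emb z)" for z
    using A.le_opD[OF CA, of z] by (intro bound) (simp_all add: A.Re_form)
  then obtain f where f: "\<And>z. p (C z) y = cinner (A.emb z) f"
    using riesz_along_clinear[OF A.clinear_emb lin] by blast
  have "norm (p (C z) y) \<le> s * norm (orth_proj L (B.emb z))" for z
    using A.le_opD[OF CL, of z] by (intro bound) (simp_all add: Re_pairing_part[OF L])
  then obtain k where k: "\<And>z. p (C z) y = cinner (orth_proj L (B.emb z)) k"
    using riesz_along_clinear[OF clinear_comp[OF B.clinear_emb clinear_orth_proj] lin] by blast
  \<comment> \<open>Moving the projection to the other side shows that \<open>f\<close> witnesses
    membership in \<open>D\<close>.\<close>
  have "orth_proj L k \<in> D"
    unfolding D_iff using f k by (metis cinner_orth_proj)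
  then have "orth_proj L k = 0"
    using disjoint orth_proj(1) by blast
  then show "p (C x) y = p 0 y"
    by (simp add: k cinner_orth_proj A.pairing_zero_left)
qed

lemma part_decomposition:
  assumes "closed_csubspace L"
    and "\<And>k. k \<in> L \<Longrightarrow> (\<And>d. d \<in> D \<inter> L \<Longrightarrow> cinner k d = 0) \<Longrightarrow> k = 0"
    and "D \<inter> orth_compl L \<subseteq> {0}"
  shows "(part L, part (orth_compl L)) \<in> lebesgue_decompositions p A B"
  unfolding lebesgue_decompositions_def
  using assms closed_csubspace_orth_compl[of L]
  by (auto intro!: positive_part part_add abs_cont_part singular_part ext)

text \<open>Density of \<open>D\<close> in \<open>orth_compl M\<close> gives absolute continuity,
  and \<open>D \<subseteq> orth_compl M\<close> gives singularity. The double complement equals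
  \<open>M\<close>; it is kept to match \<open>part_decomposition\<close>.\<close>

lemma reg_decomposition:
  "(part (orth_compl M), part (orth_compl (orth_compl M))) \<in> lebesgue_decompositions p A B"
proof (rule part_decomposition[OF MC.closed_csubspace_axioms])
  fix k assume k: "k \<in> orth_compl M" "\<And>d. d \<in> D \<inter> orth_compl M \<Longrightarrow> cinner k d = 0"
  then have "k \<in> orth_compl D"
    using D_subset by (auto simp: orth_compl_def)
  then have "k \<in> M"
    using orth_compl_D_subset by blast
  with k(1) show "k = 0"
    by (auto simp: orth_compl_def)
next
  show "D \<inter> orth_compl (orth_compl M) \<subseteq> {0}"
    using D_subset cinner_self_eq_0 unfolding orth_compl_def[of "orth_compl M"] by blast
qed

text \<open>The sequence realising \<open>(0, P B x) \<in> Bhat\<close> makes \<open>x - x\<^sub>n\<close> approximate \<open>(I - P) B x\<close> in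
  \<open>\<H>\<^sub>B\<close>, while absolute continuity makes \<open>\<langle>C x\<^sub>n, x\<^sub>n\<rangle>\<close> negligible.\<close>

lemma abs_cont_le_reg_part:
  assumes C: "positive_op p C" and CB: "\<And>x. Re (p (C x) x) \<le> Re (p (B x) x)"
    and ac: "abs_cont p A C"
  shows "Re (p (C x) x) \<le> Re (p (part (orth_compl M) x) x)"
proof -
  define m where "m = orth_proj M (B.emb x)"
  have "(0, m) \<in> R"
    using M.orth_proj(1) by (simp add: m_def mul_part_def)
  then obtain y where y: "(\<lambda>n. A.emb (y n)) \<longlonglongrightarrow> 0" "(\<lambda>n. B.emb (y n)) \<longlonglongrightarrow> m"
    by (rule R_sequence)
  have norm_form: "norm (p (C z) z) = Re (p (C z) z)" for z
    using A.positive_op_Re_ge_0[OF C, of z] A.positive_op_Im_eq_0[OF C, of z]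
    by (simp add: cmod_def)
  have "(\<lambda>n. (norm (A.emb (y n)))\<^sup>2) \<longlonglongrightarrow> (norm (0::'h))\<^sup>2"
    by (intro tendsto_intros y)
  then have "(\<lambda>n. complex_of_real ((norm (A.emb (y n)))\<^sup>2)) \<longlonglongrightarrow> complex_of_real ((norm (0::'h))\<^sup>2)"
    by (rule tendsto_of_real)
  then have "(\<lambda>n. p (A (y n)) (y n)) \<longlonglongrightarrow> 0"
    by (simp add: A.cinner_emb[symmetric] cinner_self)
  \<comment> \<open>The form of \<open>C\<close> is dominated by that of \<open>B\<close>, for which
    \<open>y\<close> is Cauchy because \<open>B.emb (y n)\<close> converges.\<close>
  moreover have "((\<lambda>(n, m). p (C (y n - y m)) (y n - y m)) \<longlongrightarrow> 0) (sequentially \<times>\<^sub>F sequentially)"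
  proof (rule tendstoI)
    fix e :: real assume "e > 0"
    have "Cauchy (\<lambda>n. B.emb (y n))"
      using y(2) by (rule LIMSEQ_imp_Cauchy)
    then obtain N where N: "\<And>m n. m \<ge> N \<Longrightarrow> n \<ge> N \<Longrightarrow> dist (B.emb (y m)) (B.emb (y n)) < sqrt e"
      using \<open>e > 0\<close> unfolding Cauchy_def by (metis real_sqrt_gt_zero)
    have "norm (p (C (y m - y n)) (y m - y n)) < e" if "m \<ge> N" "n \<ge> N" for m n
    proof -
      have "norm (p (C (y m - y n)) (y m - y n)) \<le> (norm (B.emb (y m - y n)))\<^sup>2"
        using CB[of "y m - y n"] by (simp add: norm_form B.Re_form)
      also have "norm (B.emb (y m - y n)) < sqrt e"
        using N[OF that] by (simp add: dist_norm clinear_diff[OF B.clinear_emb])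
      then have "(norm (B.emb (y m - y n)))\<^sup>2 < (sqrt e)\<^sup>2"
        by (intro power_strict_mono) auto
      finally show ?thesis
        using \<open>e > 0\<close> by simp
    qed
    then show "\<forall>\<^sub>F z in sequentially \<times>\<^sub>F sequentially.
        dist (case z of (n, m) \<Rightarrow> p (C (y n - y m)) (y n - y m)) 0 < e"
      unfolding eventually_prod_sequentially by auto
  qed
  ultimately have "(\<lambda>n. p (C (y n)) (y n)) \<longlonglongrightarrow> 0"
    using ac unfolding abs_cont_def by blast
  then have "(\<lambda>n. sqrt (Re (p (C (y n)) (y n)))) \<longlonglongrightarrow> sqrt (Re 0)"
    by (intro tendsto_real_sqrt tendsto_Re)
  moreover have "(\<lambda>n. norm (B.emb x - B.emb (y n))) \<longlonglongrightarrow> norm (B.emb x - m)"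
    by (intro tendsto_intros y)
  ultimately have "(\<lambda>n. norm (B.emb x - B.emb (y n)) + sqrt (Re (p (C (y n)) (y n))))
      \<longlonglongrightarrow> norm (B.emb x - m) + sqrt (Re 0)"
    by (intro tendsto_add)
  moreover have "sqrt (Re (p (C x) x)) \<le> norm (B.emb x - B.emb (y n)) + sqrt (Re (p (C (y n)) (y n)))" for n
  proof -
    have "sqrt (Re (p (C x) x)) \<le> sqrt (Re (p (C (x - y n)) (x - y n))) + sqrt (Re (p (C (y n)) (y n)))"
      using A.positive_op_sqrt_triangle[OF C, of "x - y n" "y n"] by simp
    also have "sqrt (Re (p (C (x - y n)) (x - y n))) \<le> norm (B.emb x - B.emb (y n))"
      using CB[of "x - y n"] by (intro real_le_lsqrt)
        (simp_all add: B.Re_form clinear_diff[OF B.clinear_emb])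
    finally show ?thesis
      by simp
  qed
  ultimately have "sqrt (Re (p (C x) x)) \<le> norm (B.emb x - m) + sqrt (Re 0)"
    by (intro LIMSEQ_le_const) auto
  then have "sqrt (Re (p (C x) x)) \<le> norm (orth_proj (orth_compl M) (B.emb x))"
    by (simp add: m_def M.orth_proj_orth_compl)
  then have "(sqrt (Re (p (C x) x)))\<^sup>2 \<le> (norm (orth_proj (orth_compl M) (B.emb x)))\<^sup>2"
    by (intro power_mono) (simp_all add: A.positive_op_Re_ge_0[OF C])
  then show ?thesis
    by (simp add: Re_pairing_part[OF MC.closed_csubspace_axioms] A.positive_op_Re_ge_0[OF C])
qed

section \<open>Uniqueness of the decomposition\<close>

lemma decomposition_unique_if_reg_bounded:
  assumes "reg_bounded" and "(B1, B2) \<in> lebesgue_decompositions p A B"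
  shows "(B1, B2) = (part (orth_compl M), part (orth_compl (orth_compl M)))"
proof -
  let ?Ba = "part (orth_compl M)"
  have B1: "positive_op p B1" and B2: "positive_op p B2" and sum: "\<And>x. B x = B1 x + B2 x"
    and ac: "abs_cont p A B1" and sing: "singular_op p A B2"
    using assms(2) by (auto simp: lebesgue_decompositions_def)
  have Ba: "positive_op p ?Ba"
    by (rule positive_part[OF MC.closed_csubspace_axioms])
  have sum_Re: "Re (p (B x) x) = Re (p (B1 x) x) + Re (p (B2 x) x)" for x
    by (simp add: sum A.pairing_add_left)
  have max: "Re (p (B1 x) x) \<le> Re (p (?Ba x) x)" for x
    by (rule abs_cont_le_reg_part[OF B1 _ ac]) (simp add: sum_Re A.positive_op_Re_ge_0[OF B2])
  obtain \<alpha> :: real where "\<alpha> \<ge> 0" and \<alpha>: "le_op p ?Ba (\<lambda>x. complex_of_real \<alpha> *\<^sub>C A x)"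
    using assms(1) unfolding le_op_iff[symmetric] B_a_eq by blast
  \<comment> \<open>One factor for both comparisons: \<open>r * \<alpha> \<le> 1\<close> serves
    \<open>C \<le> A\<close>, and \<open>r \<le> 1\<close> serves \<open>C \<le> B2\<close>. The
    maximum with 1 also keeps \<open>r\<close> defined and positive for
    \<open>\<alpha> = 0\<close>.\<close>
  define r where "r = inverse (max \<alpha> 1)"
  have r: "0 < r" "r \<le> 1" "r * \<alpha> \<le> 1"
    unfolding r_def by (simp_all add: field_simps max_def)
  define E where "E = (\<lambda>x. ?Ba x - B1 x)"
  have E: "positive_op p E"
    unfolding E_def using A.le_opI[OF B1 Ba max] by (simp add: le_op_def)
  define C where "C = (\<lambda>x. complex_of_real r *\<^sub>C E x)"
  have C: "positive_op p C"
    unfolding C_def using r by (intro A.positive_op_scaleC E) simp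
  have C_Re: "Re (p (C x) x) = r * Re (p (E x) x)" for x
    by (simp add: C_def A.pairing_scaleC_left)
  have E_Re: "Re (p (E x) x) = Re (p (?Ba x) x) - Re (p (B1 x) x)" for x
    by (simp add: E_def A.pairing_diff_left)
  have "le_op p C A"
  proof (rule A.le_opI[OF C A.positive])
    fix x
    have "r * Re (p (E x) x) \<le> r * (\<alpha> * Re (p (A x) x))"
      using A.le_opD[OF \<alpha>, of x] A.positive_op_Re_ge_0[OF B1, of x] r
      by (intro mult_left_mono) (simp_all add: E_Re A.pairing_scaleC_left)
    also have "\<dots> \<le> 1 * Re (p (A x) x)"
      unfolding mult.assoc[symmetric] using r
      by (intro mult_right_mono) (simp_all add: A.Re_form)
    finally show "Re (p (C x) x) \<le> Re (p (A x) x)"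
      by (simp add: C_Re)
  qed
  moreover have "le_op p C B2"
  proof (rule A.le_opI[OF C B2])
    fix x
    have "r * Re (p (E x) x) \<le> 1 * Re (p (E x) x)"
      using r by (intro mult_right_mono A.positive_op_Re_ge_0[OF E]) simp
    \<comment> \<open>Compression decreases the form, so \<open>E = ?Ba - B1\<close> lies below
      \<open>B - B1 = B2\<close>.\<close>
    moreover have "Re (p (?Ba x) x) \<le> Re (p (B x) x)"
      by (simp add: Re_pairing_part[OF MC.closed_csubspace_axioms] B.Re_form power_mono
          MC.norm_orth_proj_le)
    ultimately show "Re (p (C x) x) \<le> Re (p (B2 x) x)"
      using sum_Re[of x] by (simp add: C_Re E_Re)
  qed
  ultimately have "C = (\<lambda>x. 0)"
    using sing C A.positive_op_weak_ops[OF C] unfolding singular_op_def by blast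
  then have "complex_of_real r *\<^sub>C E x = 0" for x
    unfolding C_def by (rule fun_cong)
  then have "E x = 0" for x
    using r by simp
  then have "B1 = ?Ba"
    by (simp add: E_def fun_eq_iff)
  moreover have "B2 x = part (orth_compl (orth_compl M)) x" for x
    using sum[of x] part_add[OF MC.closed_csubspace_axioms, of x] \<open>B1 = ?Ba\<close> by simp
  ultimately show ?thesis
    by (simp add: fun_eq_iff)
qed

text \<open>If \<open>g \<in> \<M>\<^sup>\<bottom> - dom Bhat\<^sup>*\<close>, the rank one operator \<open>J g \<otimes> J g\<close> is singular although it lies
  below \<open>B\<^sub>a\<close>, and can be moved from the absolutely continuous part to the singular one.\<close>

lemma decomposition_not_unique:
  assumes "\<not> orth_compl M \<subseteq> D"
  obtains P where "P \<in> lebesgue_decompositions p A B"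
    "P \<noteq> (part (orth_compl M), part (orth_compl (orth_compl M)))"
proof -
  obtain g0 where g0: "g0 \<in> orth_compl M" "g0 \<notin> D"
    using assms by blast
  then have "g0 \<noteq> 0"
    using complex_vector.subspace_0[OF csubspace_D] by auto
  define g where "g = complex_of_real (inverse (norm g0)) *\<^sub>C g0"
  have gM: "g \<in> orth_compl M"
    unfolding g_def by (intro complex_vector.subspace_scale csubspace_orth_compl g0)
  have "g \<notin> D"
  proof
    assume "g \<in> D"
    then have "complex_of_real (norm g0) *\<^sub>C g \<in> D"
      by (intro complex_vector.subspace_scale csubspace_D)
    then show False
      using \<open>g0 \<noteq> 0\<close> g0(2) by (simp add: g_def)
  qed
  have gg: "cinner g g = 1"
    using \<open>g0 \<noteq> 0\<close> by (simp add: g_def cinner_self norm_scaleC norm_inverse)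
  define L where "L = orth_compl (insert g M)"
  have L_iff: "k \<in> L \<longleftrightarrow> k \<in> orth_compl M \<and> cinner k g = 0" for k
    by (auto simp: L_def orth_compl_def)
  have L: "closed_csubspace L"
    unfolding L_def by (rule closed_csubspace_orth_compl)
  interpret L: closed_csubspace L
    by fact
  have diff: "k - cinner k g *\<^sub>C g \<in> L" if "k \<in> orth_compl M" for k
    unfolding L_iff using that gM
    by (simp add: cinner_diff_left cinner_scaleC_left gg complex_vector.subspace_diff
        complex_vector.subspace_scale csubspace_orth_compl)
  \<comment> \<open>\<open>L\<close> has codimension one in \<open>orth_compl M\<close>, with
    \<open>g\<close> spanning what is left; as \<open>g\<close> is outside \<open>D\<close>, this
    line meets \<open>D\<close> only in 0.\<close>
  have orth: "k = cinner k g *\<^sub>C g" if "k \<in> orth_compl M" "k \<in> orth_compl L" for k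
  proof -
    have "g \<in> orth_compl L"
      by (auto simp: orth_compl_def L_iff cinner_eq_0_commute[of g])
    then have "k - cinner k g *\<^sub>C g \<in> orth_compl L"
      using that(2) by (intro complex_vector.subspace_diff complex_vector.subspace_scale
          csubspace_orth_compl)
    then have "cinner (k - cinner k g *\<^sub>C g) (k - cinner k g *\<^sub>C g) = 0"
      using diff[OF that(1)] unfolding orth_compl_def by blast
    then show ?thesis
      by simp
  qed
  have "(part L, part (orth_compl L)) \<in> lebesgue_decompositions p A B"
  proof (rule part_decomposition[OF L])
    show "D \<inter> orth_compl L \<subseteq> {0}"
    proof
      fix d assume d: "d \<in> D \<inter> orth_compl L"
      then have eq: "d = cinner d g *\<^sub>C g"
        using D_subset by (intro orth) auto
      have "cinner d g = 0"
      proof (rule ccontr)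
        assume "cinner d g \<noteq> 0"
        then have "g = inverse (cinner d g) *\<^sub>C d"
          by (subst eq) simp
        then have "g \<in> D"
          using d complex_vector.subspace_scale[OF csubspace_D] by (metis IntD1)
        then show False
          using \<open>g \<notin> D\<close> by blast
      qed
      then show "d \<in> {0}"
        using eq by simp
    qed
  next
    fix k assume k: "k \<in> L" "\<And>d. d \<in> D \<inter> L \<Longrightarrow> cinner k d = 0"
    have "g \<notin> orth_compl D"
    proof
      assume "g \<in> orth_compl D"
      then have "g \<in> M"
        using orth_compl_D_subset by blast
      then show False
        using gM gg by (auto simp: orth_compl_def)
    qed
    then obtain d1 where d1: "d1 \<in> D" "cinner d1 g \<noteq> 0"
      using cinner_eq_0_commute by (auto simp: orth_compl_def)
    \<comment> \<open>Normalised so that subtracting \<open>cinner d g *\<^sub>C d0\<close> moves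
      any \<open>d\<close> of \<open>D\<close> into \<open>D \<inter> L\<close>.\<close>
    define d0 where "d0 = inverse (cinner d1 g) *\<^sub>C d1"
    have d0: "d0 \<in> D" "cinner d0 g = 1"
      using d1 complex_vector.subspace_scale[OF csubspace_D]
      by (simp_all add: d0_def cinner_scaleC_left)
    \<comment> \<open>Orthogonality of \<open>k\<close> to the corrected vectors of
      \<open>D \<inter> L\<close> becomes orthogonality of this vector to all of \<open>D\<close>;
      it then lies in both \<open>M\<close> and \<open>orth_compl M\<close>.\<close>
    have "k - cinner k d0 *\<^sub>C g \<in> orth_compl D"
      unfolding orth_compl_def mem_Collect_eq
    proof
      fix d assume "d \<in> D"
      then have "d - cinner d g *\<^sub>C d0 \<in> D"
        using d0 complex_vector.subspace_diff[OF csubspace_D]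
          complex_vector.subspace_scale[OF csubspace_D] by blast
      moreover have "cinner (d - cinner d g *\<^sub>C d0) g = 0"
        by (simp add: cinner_diff_left cinner_scaleC_left d0)
      ultimately have "cinner k (d - cinner d g *\<^sub>C d0) = 0"
        using D_subset by (intro k) (auto simp: L_iff)
      then show "cinner (k - cinner k d0 *\<^sub>C g) d = 0"
        by (simp add: cinner_diff_left cinner_diff_right cinner_scaleC_left cinner_scaleC_right
            cinner_commute[of g d] mult.commute)
    qed
    then have "k - cinner k d0 *\<^sub>C g \<in> M"
      using orth_compl_D_subset by blast
    moreover have "k - cinner k d0 *\<^sub>C g \<in> orth_compl M"
      using k(1) gM by (intro complex_vector.subspace_diff complex_vector.subspace_scale
          csubspace_orth_compl) (simp_all add: L_iff)
    ultimately have "cinner (k - cinner k d0 *\<^sub>C g) (k - cinner k d0 *\<^sub>C g) = 0"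
      unfolding orth_compl_def by blast
    then have eq: "k = cinner k d0 *\<^sub>C g"
      by simp
    then have "cinner k g = cinner k d0 * cinner g g"
      by (metis cinner_scaleC_left)
    then show "k = 0"
      using k(1) eq gg by (simp add: L_iff)
  qed
  moreover have "part L \<noteq> part (orth_compl M)"
  proof
    assume eq: "part L = part (orth_compl M)"
    \<comment> \<open>Equal compressions force equal projections on a dense set; by self-adjointness
      \<open>g\<close> would equal its projection to \<open>L\<close>, which is 0.\<close>
    have "orth_proj L (B.emb x) = orth_proj (orth_compl M) (B.emb x)" for x
    proof -
      have "cinner (B.emb y) (orth_proj L (B.emb x) - orth_proj (orth_compl M) (B.emb x)) = 0" for y
        using pairing_part[of L x y] pairing_part[of "orth_compl M" x y] cinner_eq_0_commute
        by (simp add: eq cinner_diff_left cinner_eq_0_commute[of "B.emb y"])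
      then show ?thesis
        using B.orthogonal_emb_eq_0 by (metis right_minus_eq)
    qed
    then have "cinner (B.emb x) g = cinner (B.emb x) (orth_proj L g)" for x
      using L.cinner_orth_proj[of "B.emb x" g] MC.cinner_orth_proj[of "B.emb x" g]
      by (simp add: MC.orth_proj_id[OF gM])
    moreover have "orth_proj L g = 0"
      by (rule orth_proj_eqI[OF L.csubspace])
        (auto simp: orth_compl_def L_iff cinner_eq_0_commute[of g] complex_vector.subspace_0[OF L.csubspace])
    ultimately have "g = 0"
      by (intro B.orthogonal_emb_eq_0) simp
    then show False
      using gg by simp
  qed
  ultimately show thesis
    using that by blast
qed

lemma decomposition_unique_iff: "(\<exists>!P. P \<in> lebesgue_decompositions p A B) \<longleftrightarrow> reg_bounded"
proof
  assume "\<exists>!P. P \<in> lebesgue_decompositions p A B"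
  then show reg_bounded
    unfolding reg_bounded_iff using decomposition_not_unique reg_decomposition by metis
next
  assume reg_bounded
  then show "\<exists>!P. P \<in> lebesgue_decompositions p A B"
    using decomposition_unique_if_reg_bounded reg_decomposition by (metis surj_pair)
qed

end

theorem theorem7p2:
  fixes p :: "'f::complex_vector \<Rightarrow> 'e::complex_vector \<Rightarrow> complex"
    and A B :: "'e \<Rightarrow> 'f"
    and \<iota>A :: "'f \<Rightarrow> 'h::chilbert_space"
    and \<iota>B :: "'f \<Rightarrow> 'k::chilbert_space"
  assumes "anti_dual_pair p" and "weak_star_seq_complete p"
    and "A \<in> weak_ops p" and "positive_op p A"
    and "B \<in> weak_ops p" and "positive_op p B"
    and "hilbert_completion p A \<iota>A" and "hilbert_completion p B \<iota>B"
  defines "Bhat \<equiv> B_hat A \<iota>A B \<iota>B"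
  shows
    "((\<exists>!D. D \<in> lebesgue_decompositions p A B) \<longleftrightarrow> closed (Domain (rel_adjoint Bhat))) \<and>
     (closed (Domain (rel_adjoint Bhat)) \<longleftrightarrow>
        continuous_on (Domain (reg_part Bhat)) (graph_op (reg_part Bhat))) \<and>
     (continuous_on (Domain (reg_part Bhat)) (graph_op (reg_part Bhat)) \<longleftrightarrow>
        (\<exists>\<alpha>::real. \<alpha> \<ge> 0 \<and>
           le_op p (B_a p A \<iota>A B \<iota>B) (\<lambda>x. complex_of_real \<alpha> *\<^sub>C A x))) \<and>
     ((\<exists>\<alpha>::real. \<alpha> \<ge> 0 \<and>
           le_op p (B_a p A \<iota>A B \<iota>B) (\<lambda>x. complex_of_real \<alpha> *\<^sub>C A x)) \<longleftrightarrow>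
        J_op p B \<iota>B ` orth_compl (mul_part Bhat) \<subseteq> range (J_op p A \<iota>A))"
proof -
  interpret positive_pair p A B \<iota>A \<iota>B
    using assms by unfold_locales
  show ?thesis
    \<comment> \<open>Each of the five conditions rewrites to
      \<open>orth_compl M \<subseteq> D\<close>.\<close>
    unfolding Bhat_def decomposition_unique_iff closed_D_iff continuous_reg_part_iff le_op_iff
      J_image_iff reg_bounded_iff by simp
qed

end
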